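(* Let $n\ge1$ be an integer and $q$ a prime power. For every function $f:\mathbb{F}_q^n\to\mathbb{C}$, $$\sum_{x\in\mathbb{F}_q^n}|f(x)|^n\ \ge\ \frac{1}{(2-1/q)^n}\,\frac{1}{|\mathbb{P}\mathbb{F}_q^{n-1}|}\sum_{u\in\mathbb{P}\mathbb{F}_q^{n-1}}|f^*(u)|^n .$$
   Context: $\mathbb{P}\mathbb{F}_q^{n-1}$ is the set of nonzero vectors of $\mathbb{F}_q^n$ up to multiplication by $\mathbb{F}_q^\times$ (the set of directions of lines in $\mathbb{F}_q^n$), with one representative in $\mathbb{F}_q^n$ fixed for each element. The maximal function of $f$ is $f^*(u)=\sup_{a\in\mathbb{F}_q^n}\sum_{t\in\mathbb{F}_q}|f(a+tu)|$ for $u\in\mathbb{P}\mathbb{F}_q^{n-1}$. *)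

theory Defs
  imports "HOL-Analysis.Finite_Cartesian_Product"
begin

text \<open>
  The field with q elements is a type of class field and finite, with q its cardinality;
  n-dimensional space over it is the type of vectors indexed by a finite type of cardinality n.
\<close>

definition proportional :: "('a::field ^ 'n::finite) rel" where
  "proportional = {(u, v). u \<noteq> 0 \<and> v \<noteq> 0 \<and> (\<exists>c. c \<noteq> 0 \<and> v = c *s u)}"

definition directions :: "('a::field ^ 'n::finite) set set" where
  "directions = {v. v \<noteq> 0} // proportional"

definition representatives :: "(('a::field ^ 'n::finite) set \<Rightarrow> 'a ^ 'n) \<Rightarrow> bool" where
  "representatives r \<longleftrightarrow> (\<forall>U\<in>directions. r U \<in> U)"

text \<open>The supremum is over a finite nonempty set of reals, so it is a genuine supremum.\<close>

definition maximal_function ::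
  "('a::{field,finite} ^ 'n::finite \<Rightarrow> complex) \<Rightarrow> 'a ^ 'n \<Rightarrow> real" where
  "maximal_function f u = (SUP a. \<Sum>t\<in>UNIV. cmod (f (a + t *s u)))"

end

theory Submission
  imports Defs "HOL-Analysis.Cartesian_Space" "HOL-Computational_Algebra.Polynomial"
    "HOL-Library.Function_Algebras"
begin

text \<open>
  The proof is a weighted method of multiplicities. Replace \<open>\<bar>f x\<bar>\<close> by an integer weight
  \<open>m x \<approx> k \<bar>f x\<bar>\<close> and let \<open>K\<close> be the space of polynomials vanishing to order \<open>m x\<close> at every
  point \<open>x\<close>; its codimension is at most about \<open>\<Sum>x. (m x) ^ n / n!\<close>. If the line in direction \<open>u\<close>
  of largest weight has weight \<open>W u\<close>, then for every degree \<open>d < W u / (2 - 1 / q)\<close> the top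
  homogeneous part of an element of \<open>K\<close> of degree \<open>d\<close> vanishes at \<open>u\<close> to order exceeding
  \<open>d / q\<close>. No nonzero form of degree \<open>d\<close> vanishes to such an order at all directions, and by
  submodularity and the transitivity of the general linear group on directions, vanishing on a set
  of directions of density \<open>\<delta>\<close> costs at least the proportion \<open>\<delta>\<close> of the dimension of the space
  of forms. Summing over \<open>d\<close> bounds the codimension of \<open>K\<close> below by about the average over \<open>u\<close> of
  \<open>(W u / (2 - 1 / q)) ^ n / n!\<close>, and \<open>k \<rightarrow> \<infinity>\<close> gives the theorem. Dimensions over the field with
  \<open>q\<close> elements are handled as cardinalities of finite groups, and polynomials as functions on an
  infinite extension, which determine their coefficients.
\<close>

section \<open>Counting in finite abelian groups\<close>

text \<open>The constant 2 - 1/q is a trade-off. On a plane through the heaviest line of direction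
  u, let t be transversal to the line. Passing to the coefficient of t^i costs i at each of the q
  points of the line, so that coefficient is forced to be 0 once d - i < W u - q i, that is d + (q -
  1) i < W u. To leave no nonzero form of degree d, the order at the directions must exceed d/q, so
  i has to run up to d/q, and the worst case i = d/q reads d (2 - 1/q) < W u. The obstacle is that W
  u varies with u: in degree d only the directions with large W u are constrained, so a lemma about
  vanishing at all directions is not enough. A cost linear in the number of constrained directions
  makes the degrees add up: summed over d, it counts for every u the monomials of degree up to about
  W u / (2 - 1/q). This count is the source of the n-th power, and its factor 1/n! is the same as in
  the codimension of \<open>K\<close>. Rounding and lower-order terms are o(k^n), so no constant is
  lost.\<close>

definition additive_subgroup :: "'g::ab_group_add set \<Rightarrow> bool" where
  "additive_subgroup A \<longleftrightarrow> 0 \<in> A \<and> (\<forall>x\<in>A. \<forall>y\<in>A. x - y \<in> A)"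

lemma additive_subgroup_diff: "additive_subgroup A \<Longrightarrow> x \<in> A \<Longrightarrow> y \<in> A \<Longrightarrow> x - y \<in> A"
  by (simp add: additive_subgroup_def)

lemma additive_subgroup_Int:
  "additive_subgroup A \<Longrightarrow> additive_subgroup B \<Longrightarrow> additive_subgroup (A \<inter> B)"
  by (simp add: additive_subgroup_def)

lemma card_additive_subgroup_pos: "additive_subgroup A \<Longrightarrow> finite A \<Longrightarrow> card A > 0"
  by (auto simp: additive_subgroup_def card_gt_0_iff)

lemma card_le_card_fibers:
  assumes "finite T" "finite S" "g ` S \<subseteq> T" "\<And>y. y \<in> T \<Longrightarrow> card {x\<in>S. g x = y} \<le> k"
  shows "card S \<le> card T * k"
proof -
  have "S = (\<Union>y\<in>T. {x\<in>S. g x = y})"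
    using assms(3) by auto
  then have "card S \<le> (\<Sum>y\<in>T. card {x\<in>S. g x = y})"
    using card_UN_le[OF assms(1), of "\<lambda>y. {x\<in>S. g x = y}"] by simp
  also have "\<dots> \<le> card T * k"
    using sum_bounded_above[of T "\<lambda>y. card {x\<in>S. g x = y}" k] assms(4) by simp
  finally show ?thesis .
qed

text \<open>Nonempty fibres of subtraction on \<open>A \<times> B\<close> are cosets of the
  intersection, and the image lies in \<open>C\<close>. For dimensions this is submodularity of
  codimension.\<close>

lemma card_subgroups_le:
  assumes C: "additive_subgroup C" "finite C"
    and A: "additive_subgroup A" "A \<subseteq> C" and B: "additive_subgroup B" "B \<subseteq> C"
  shows "card A * card B \<le> card C * card (A \<inter> B)"
proof -
  have fin: "finite A" "finite B"
    using A(2) B(2) C(2) by (auto intro: finite_subset)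
  have "card (A \<times> B) \<le> card C * card (A \<inter> B)"
  proof (rule card_le_card_fibers[where g = "\<lambda>(a, b). a - b"])
    show "(\<lambda>(a, b). a - b) ` (A \<times> B) \<subseteq> C"
      using A B C(1) by (auto intro: additive_subgroup_diff)
    fix c assume "c \<in> C"
    define F where "F = {x \<in> A \<times> B. (case x of (a, b) \<Rightarrow> a - b) = c}"
    show "card F \<le> card (A \<inter> B)"
    proof (cases "F = {}")
      case False
      then obtain a b where ab: "a \<in> A" "b \<in> B" "a - b = c"
        by (auto simp: F_def)
      show ?thesis
      proof (rule card_inj_on_le[where f = "\<lambda>x. fst x - a"])
        show "inj_on (\<lambda>x. fst x - a) F"
          by (auto simp: F_def inj_on_def)
        show "(\<lambda>x. fst x - a) ` F \<subseteq> A \<inter> B"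
        proof (rule image_subsetI)
          fix x assume "x \<in> F"
          then obtain a' b' where x: "x = (a', b')" "a' \<in> A" "b' \<in> B" "a' - b' = a - b"
            by (auto simp: F_def ab)
          have "a' = a - b + b'"
            using x(4) by (simp add: diff_eq_eq)
          then have "a' - a = b' - b"
            by simp
          then show "fst x - a \<in> A \<inter> B"
            using additive_subgroup_diff[OF A(1) x(2) ab(1)] additive_subgroup_diff[OF B(1) x(3) ab(2)] x(1)
            by simp
        qed
      qed (use fin in auto)
    qed auto
  qed (use fin C in auto)
  then show ?thesis
    by (simp add: card_cartesian_product)
qed

text \<open>\<open>q ^ k x\<close> bounds the index of \<open>A x\<close>, and indices multiply at
  worst: \<open>card_subgroups_le\<close> is applied to the partial intersection and the next group,
  and one factor \<open>card C\<close> cancels. This will bound the codimension of the polynomials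
  with prescribed multiplicities.\<close>

lemma card_INT_subgroups_le:
  assumes C: "additive_subgroup C" "finite C"
    and A: "\<And>x. x \<in> X \<Longrightarrow> additive_subgroup (A x)" "\<And>x. x \<in> X \<Longrightarrow> A x \<subseteq> C"
    and bound: "\<And>x. x \<in> X \<Longrightarrow> card C \<le> q ^ k x * card (A x)"
    and "finite X"
  shows "card C \<le> q ^ (\<Sum>x\<in>X. k x) * card {c\<in>C. \<forall>x\<in>X. c \<in> A x}"
  using \<open>finite X\<close> A bound
proof (induction X rule: finite_induct)
  case (insert y X)
  define D where "D = {c\<in>C. \<forall>x\<in>X. c \<in> A x}"
  have D: "additive_subgroup D" "D \<subseteq> C"
    using C insert.prems(1) by (auto simp: D_def additive_subgroup_def)
  have IH: "card C \<le> q ^ (\<Sum>x\<in>X. k x) * card D"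
    unfolding D_def using insert.prems by (intro insert.IH) auto
  have inter: "{c\<in>C. \<forall>x\<in>insert y X. c \<in> A x} = D \<inter> A y"
    by (auto simp: D_def)
  have "card C * card C \<le> (q ^ (\<Sum>x\<in>X. k x) * card D) * (q ^ k y * card (A y))"
    using IH insert.prems(3)[of y] by (intro mult_mono) auto
  also have "\<dots> = q ^ (\<Sum>x\<in>insert y X. k x) * (card D * card (A y))"
    using insert.hyps by (simp add: power_add)
  also have "\<dots> \<le> q ^ (\<Sum>x\<in>insert y X. k x) * (card C * card (D \<inter> A y))"
    using card_subgroups_le[OF C D insert.prems(1,2)[of y]] by (intro mult_left_mono) auto
  finally have "card C * card C \<le> card C * (q ^ (\<Sum>x\<in>insert y X. k x) * card (D \<inter> A y))"
    by (simp add: mult_ac)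
  then show ?case
    unfolding inter using card_additive_subgroup_pos[OF C] by simp
qed simp

text \<open>Two elements of \<open>K\<close> with the same representative in \<open>T\<close> differ
  by an element of \<open>L\<close>. Used for one degree step: \<open>L\<close> is the space of
  polynomials of smaller degree and \<open>T\<close> the set of admissible top forms.\<close>

lemma card_subgroup_le_card_quotient:
  assumes K: "additive_subgroup K" "finite K" and L: "additive_subgroup L"
    and T: "finite T" "\<And>x. x \<in> K \<Longrightarrow> \<exists>g\<in>T. x - g \<in> L"
  shows "card K \<le> card (K \<inter> L) * card T"
proof -
  obtain g where g: "\<And>x. x \<in> K \<Longrightarrow> g x \<in> T \<and> x - g x \<in> L"
    using bchoice[of K "\<lambda>x g. g \<in> T \<and> x - g \<in> L"] T(2) by blast
  have "card K \<le> card T * card (K \<inter> L)"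
  proof (rule card_le_card_fibers[where g = g])
    fix t assume "t \<in> T"
    show "card {x\<in>K. g x = t} \<le> card (K \<inter> L)"
    proof (cases "{x\<in>K. g x = t} = {}")
      case False
      then obtain y where y: "y \<in> K" "g y = t"
        by auto
      show ?thesis
      proof (rule card_inj_on_le[where f = "\<lambda>x. x - y"])
        show "(\<lambda>x. x - y) ` {x\<in>K. g x = t} \<subseteq> K \<inter> L"
        proof (rule image_subsetI)
          fix x assume "x \<in> {x\<in>K. g x = t}"
          then have x: "x \<in> K" "g x = t"
            by auto
          have "x - t \<in> L" "y - t \<in> L"
            using g[OF x(1)] g[OF y(1)] x(2) y(2) by auto
          then have "(x - t) - (y - t) \<in> L"
            by (rule additive_subgroup_diff[OF L])
          then show "x - y \<in> K \<inter> L"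
            using additive_subgroup_diff[OF K(1) x(1) y(1)] by simp
        qed
      qed (use K in \<open>auto simp: inj_on_def\<close>)
    next
      case True
      show ?thesis
        unfolding True by simp
    qed
  qed (use K T g in auto)
  then show ?thesis
    by (simp add: mult.commute)
qed

text \<open>For a fixed ordering of \<open>X\<close>, submodularity bounds the codimension imposed by the points of
  \<open>W\<close> from below by the sum of their marginal codimensions in that ordering; averaging over the
  translates \<open>\<gamma> ` U\<close> makes every marginal count with weight \<open>card U / card X\<close>.\<close>

lemma ln_card_conditions_le:
  fixes S :: "'g::ab_group_add set" and V :: "'x \<Rightarrow> 'g set" and \<Gamma> :: "('x \<Rightarrow> 'x) set"
  defines "VV \<equiv> \<lambda>W. {f\<in>S. \<forall>u\<in>W. f \<in> V u}"
  assumes S: "additive_subgroup S" "finite S"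
    and V: "\<And>u. u \<in> X \<Longrightarrow> additive_subgroup (V u)"
    and X: "finite X" and \<Gamma>: "finite \<Gamma>" "\<Gamma> \<noteq> {}"
    and perm: "\<And>\<gamma>. \<gamma> \<in> \<Gamma> \<Longrightarrow> inj_on \<gamma> X \<and> \<gamma> ` X \<subseteq> X"
    and invariant: "\<And>\<gamma> W. \<gamma> \<in> \<Gamma> \<Longrightarrow> W \<subseteq> X \<Longrightarrow> card (VV W) \<le> card (VV (\<gamma> ` W))"
    and transitive: "\<And>u v. u \<in> X \<Longrightarrow> v \<in> X \<Longrightarrow> card {\<gamma>\<in>\<Gamma>. \<gamma> u = v} * card X = card \<Gamma>"
    and trivial: "card (VV X) = 1"
    and U: "U \<subseteq> X"
  shows "card X * ln (card (VV U)) \<le> (real (card X) - card U) * ln (card S)"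
proof -
  define h where "h W = ln (real (card (VV W)))" for W
  define N where "N = card X"
  obtain e where e: "bij_betw e {..<N} X"
    using ex_bij_betw_nat_finite[OF X] by (auto simp: N_def atLeast0LessThan)
  have eX: "e j \<in> X" if "j < N" for j
    using e that by (auto simp: bij_betw_def)
  have VV_subgroup: "additive_subgroup (VV W)" if "W \<subseteq> X" for W
    using S V that by (auto simp: additive_subgroup_def VV_def)
  have VV_fin: "finite (VV W)" for W
    using S by (auto simp: VV_def)
  have VV_pos: "real (card (VV W)) > 0" if "W \<subseteq> X" for W
    using card_additive_subgroup_pos[OF VV_subgroup[OF that] VV_fin] by simp
  have submodular: "h A + h B \<le> h (A \<inter> B) + h (A \<union> B)" if "A \<subseteq> X" "B \<subseteq> X" for A B
  proof -
    have AB: "A \<inter> B \<subseteq> X" "A \<union> B \<subseteq> X"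
      using that by auto
    have "VV A \<inter> VV B = VV (A \<union> B)" "VV A \<subseteq> VV (A \<inter> B)" "VV B \<subseteq> VV (A \<inter> B)"
      by (auto simp: VV_def)
    then have "card (VV A) * card (VV B) \<le> card (VV (A \<inter> B)) * card (VV (A \<union> B))"
      using card_subgroups_le[OF VV_subgroup[OF AB(1)] VV_fin VV_subgroup[OF that(1)] _ VV_subgroup[OF that(2)]]
      by simp
    then have "ln (real (card (VV A)) * card (VV B)) \<le> ln (real (card (VV (A \<inter> B))) * card (VV (A \<union> B)))"
      using VV_pos[OF that(1)] VV_pos[OF that(2)] VV_pos[OF AB(1)] VV_pos[OF AB(2)]
      by (subst ln_le_cancel_iff) (simp_all flip: of_nat_mult)
    then show ?thesis
      using VV_pos[OF that(1)] VV_pos[OF that(2)] VV_pos[OF AB(1)] VV_pos[OF AB(2)]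
      by (simp add: h_def ln_mult)
  qed
  \<comment> \<open>The codimension, on the logarithmic scale, that the j-th point adds to its
    predecessors.\<close>
  define r where "r j = h (e ` {..<j}) - h (e ` {..<Suc j})" for j
  have h_empty: "h {} = ln (card S)"
    by (simp add: h_def VV_def)
  have h_X: "h X = 0"
    using trivial by (simp add: h_def)
  have marginals: "(\<Sum>j<N. if e j \<in> W then r j else 0) \<le> h {} - h W" if W: "W \<subseteq> X" for W
  proof -
    have "(\<Sum>k<j. if e k \<in> W then r k else 0) \<le> h {} - h (W \<inter> e ` {..<j})" if "j \<le> N" for j
      using that
    proof (induction j)
      case (Suc j)
      have sub: "e ` {..<j} \<subseteq> X" "e j \<in> X"
        using Suc.prems eX by auto
      show ?case
      proof (cases "e j \<in> W")
        case True
        have notin: "e j \<notin> e ` {..<j}"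
        proof
          assume "e j \<in> e ` {..<j}"
          then obtain k where "k < j" "e k = e j"
            by auto
          then show False
            using e Suc.prems unfolding bij_betw_def inj_on_def by fastforce
        qed
        have "e ` {..<j} \<inter> (W \<inter> e ` {..<Suc j}) = W \<inter> e ` {..<j}"
          "e ` {..<j} \<union> (W \<inter> e ` {..<Suc j}) = e ` {..<Suc j}"
          using True notin by (auto simp: lessThan_Suc)
        \<comment> \<open>Submodularity: the new point costs at least as much on top of the earlier
          points of \<open>W\<close> as on top of all earlier points.\<close>
        then have "h (e ` {..<j}) + h (W \<inter> e ` {..<Suc j}) \<le> h (W \<inter> e ` {..<j}) + h (e ` {..<Suc j})"
          using submodular[OF sub(1), of "W \<inter> e ` {..<Suc j}"] W by (simp add: le_infI1)
        then show ?thesis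
          using Suc True by (simp add: r_def)
      next
        case False
        then have "W \<inter> e ` {..<Suc j} = W \<inter> e ` {..<j}"
          by (auto simp: lessThan_Suc)
        then show ?thesis
          using Suc False by simp
      qed
    qed simp
    from this[of N] show ?thesis
      using e W by (simp add: bij_betw_def Int_absorb2)
  qed
  \<comment> \<open>Every point lies in the translate of \<open>U\<close> for the same proportion,
    \<open>card U / card X\<close>, of the permutations.\<close>
  have count: "real (card {\<gamma>\<in>\<Gamma>. v \<in> \<gamma> ` U}) * N = real (card U) * card \<Gamma>" if v: "v \<in> X" for v
  proof -
    have "{\<gamma>\<in>\<Gamma>. v \<in> \<gamma> ` U} = (\<Union>u\<in>U. {\<gamma>\<in>\<Gamma>. \<gamma> u = v})"
      by auto
    also have "card \<dots> = (\<Sum>u\<in>U. card {\<gamma>\<in>\<Gamma>. \<gamma> u = v})"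
    proof (rule card_UN_disjoint)
      show "finite U"
        using U X by (rule finite_subset)
      show "\<forall>u\<in>U. \<forall>u'\<in>U. u \<noteq> u' \<longrightarrow> {\<gamma>\<in>\<Gamma>. \<gamma> u = v} \<inter> {\<gamma>\<in>\<Gamma>. \<gamma> u' = v} = {}"
      proof (intro ballI impI)
        fix u u' assume "u \<in> U" "u' \<in> U" "u \<noteq> u'"
        then have "\<gamma> u' \<noteq> \<gamma> u" if "\<gamma> \<in> \<Gamma>" for \<gamma>
          using perm[OF that] U by (auto simp: inj_on_def)
        then show "{\<gamma>\<in>\<Gamma>. \<gamma> u = v} \<inter> {\<gamma>\<in>\<Gamma>. \<gamma> u' = v} = {}"
          by blast
      qed
    qed (use \<Gamma> in auto)
    finally have "card {\<gamma>\<in>\<Gamma>. v \<in> \<gamma> ` U} * N = (\<Sum>u\<in>U. card {\<gamma>\<in>\<Gamma>. \<gamma> u = v} * N)"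
      by (simp add: sum_distrib_right)
    also have "\<dots> = (\<Sum>u\<in>U. card \<Gamma>)"
      using U v by (intro sum.cong refl) (auto simp: N_def intro: transitive)
    finally have "real (card {\<gamma>\<in>\<Gamma>. v \<in> \<gamma> ` U} * N) = real (card U * card \<Gamma>)"
      by simp
    then show ?thesis
      by (simp only: of_nat_mult)
  qed
  \<comment> \<open>The marginals telescope to the full codimension because \<open>VV X\<close> is
    trivial.\<close>
  have "card U * card \<Gamma> * ln (card S) = card U * card \<Gamma> * (\<Sum>j<N. r j)"
  proof -
    have "(\<Sum>j<N. r j) = h {} - h (e ` {..<N})"
      unfolding r_def by (induction N) auto
    then show ?thesis
      using e by (simp add: bij_betw_def h_empty h_X)
  qed
  also have "\<dots> = (\<Sum>j<N. N * (real (card {\<gamma>\<in>\<Gamma>. e j \<in> \<gamma> ` U}) * r j))"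
    unfolding sum_distrib_left
  proof (intro sum.cong refl)
    fix j assume "j \<in> {..<N}"
    then have "real (card U * card \<Gamma>) * r j = real (card {\<gamma>\<in>\<Gamma>. e j \<in> \<gamma> ` U}) * N * r j"
      using count[OF eX] by simp
    then show "real (card U * card \<Gamma>) * r j = N * (real (card {\<gamma>\<in>\<Gamma>. e j \<in> \<gamma> ` U}) * r j)"
      by (simp only: mult.commute[of _ "real N"] mult.assoc)
  qed
  also have "\<dots> = N * (\<Sum>j<N. \<Sum>\<gamma>\<in>\<Gamma>. if e j \<in> \<gamma> ` U then r j else 0)"
  proof -
    have "real (card {\<gamma>\<in>\<Gamma>. e j \<in> \<gamma> ` U}) * r j = (\<Sum>\<gamma>\<in>\<Gamma>. if e j \<in> \<gamma> ` U then r j else 0)" for j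
      using sum.inter_filter[OF \<Gamma>(1), of "\<lambda>_. r j" "\<lambda>\<gamma>. e j \<in> \<gamma> ` U"] by simp
    then show ?thesis
      by (simp add: sum_distrib_left)
  qed
  also have "\<dots> = N * (\<Sum>\<gamma>\<in>\<Gamma>. \<Sum>j<N. if e j \<in> \<gamma> ` U then r j else 0)"
    by (subst sum.swap) simp
  also have "\<dots> \<le> N * (\<Sum>\<gamma>\<in>\<Gamma>. h {} - h U)"
  proof (intro mult_left_mono sum_mono)
    fix \<gamma> assume \<gamma>: "\<gamma> \<in> \<Gamma>"
    have sub: "\<gamma> ` U \<subseteq> X"
      using perm[OF \<gamma>] U by auto
    have "h U \<le> h (\<gamma> ` U)"
      using invariant[OF \<gamma> U] VV_pos[OF U] by (simp add: h_def)
    then show "(\<Sum>j<N. if e j \<in> \<gamma> ` U then r j else 0) \<le> h {} - h U"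
      using marginals[OF sub] by simp
  qed simp
  also have "\<dots> = card \<Gamma> * (N * (ln (card S) - h U))"
    by (simp add: h_empty mult_ac)
  finally have "card \<Gamma> * (card U * ln (card S)) \<le> card \<Gamma> * (N * (ln (card S) - h U))"
    by (simp add: mult_ac)
  then have "card U * ln (card S) \<le> N * (ln (card S) - h U)"
    using \<Gamma> by (simp add: card_gt_0_iff mult_le_cancel_left)
  then show ?thesis
    by (simp add: h_def N_def algebra_simps)
qed

section \<open>Polynomial functions over an infinite extension of a finite field\<close>

definition monomial :: "('n::finite \<Rightarrow> nat) \<Rightarrow> ('n \<Rightarrow> 'k) \<Rightarrow> 'k::comm_ring_1" where
  "monomial \<alpha> x = (\<Prod>i\<in>UNIV. x i ^ \<alpha> i)"

text \<open>A window of total degrees: \<open>exponents 0 d\<close> gives the polynomials of degree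
  at most d, \<open>exponents d d\<close> the forms of degree d, and a lower end m expresses order
  at least m at the origin.\<close>

definition exponents :: "nat \<Rightarrow> nat \<Rightarrow> ('n::finite \<Rightarrow> nat) set" where
  "exponents m d = {\<alpha>. m \<le> sum \<alpha> UNIV \<and> sum \<alpha> UNIV \<le> d}"

lemma exponents_iff: "\<alpha> \<in> exponents m d \<longleftrightarrow> m \<le> sum \<alpha> UNIV \<and> sum \<alpha> UNIV \<le> d"
  by (simp add: exponents_def)

lemma exponent_le_sum: "\<alpha> i \<le> sum \<alpha> UNIV" for \<alpha> :: "'n::finite \<Rightarrow> nat"
  by (simp add: member_le_sum)

lemma finite_exponents [simp]: "finite (exponents m d :: ('n::finite \<Rightarrow> nat) set)"
proof -
  have "exponents m d \<subseteq> (PiE UNIV (\<lambda>_. {..d}) :: ('n \<Rightarrow> nat) set)"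
    unfolding exponents_def by (auto intro: order_trans[OF exponent_le_sum])
  then show ?thesis
    by (rule finite_subset) (simp add: finite_PiE)
qed

lemma monomial_add: "monomial (\<alpha> + \<beta>) x = monomial \<alpha> x * monomial \<beta> x"
  by (simp add: monomial_def power_add prod.distrib)

lemma monomial_0 [simp]: "monomial 0 x = 1"
  by (simp add: monomial_def)

lemma monomial_scale: "monomial \<alpha> (\<lambda>i. t * x i) = t ^ sum \<alpha> UNIV * monomial \<alpha> x"
  by (simp add: monomial_def power_mult_distrib prod.distrib power_sum)

section \<open>Kronecker substitution and independence of monomials\<close>

lemma digits_unique:
  fixes a b :: "nat \<Rightarrow> nat"
  assumes "\<And>k. k < n \<Longrightarrow> a k < B" "\<And>k. k < n \<Longrightarrow> b k < B"
    and "(\<Sum>k<n. a k * B ^ k) = (\<Sum>k<n. b k * B ^ k)"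
  shows "\<forall>k<n. a k = b k"
  using assms
proof (induction n arbitrary: a b)
  case (Suc n)
  have expand: "(\<Sum>k<Suc n. c k * B ^ k) = c 0 + B * (\<Sum>k<n. c (Suc k) * B ^ k)" for c :: "nat \<Rightarrow> nat"
    by (simp only: sum.lessThan_Suc_shift sum_distrib_left) (simp add: algebra_simps)
  have eq: "a 0 + B * (\<Sum>k<n. a (Suc k) * B ^ k) = b 0 + B * (\<Sum>k<n. b (Suc k) * B ^ k)"
    using Suc.prems(3) unfolding expand .
  have lt: "a 0 < B" "b 0 < B"
    using Suc.prems by auto
  have "a 0 = b 0"
    using arg_cong[OF eq, of "\<lambda>x. x mod B"] lt by simp
  moreover have "(\<Sum>k<n. a (Suc k) * B ^ k) = (\<Sum>k<n. b (Suc k) * B ^ k)"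
    using eq \<open>a 0 = b 0\<close> lt by simp
  then have "\<forall>k<n. a (Suc k) = b (Suc k)"
    using Suc.prems by (intro Suc.IH) auto
  ultimately show ?case
    by (metis less_Suc_eq_0_disj)
qed simp

text \<open>With a base \<open>B\<close> above every exponent occurring in \<open>M\<close>, the
  weights \<open>B ^ h i\<close> make an exponent vector the digit sequence of a number, so distinct
  vectors stay distinct.\<close>

lemma kronecker_weights:
  assumes "finite M"
  obtains w :: "'n::finite \<Rightarrow> nat" where "inj_on (\<lambda>\<alpha>::'n \<Rightarrow> nat. \<Sum>i\<in>UNIV. w i * \<alpha> i) M"
proof -
  obtain h where h: "bij_betw h (UNIV :: 'n set) {..<CARD('n)}"
    using ex_bij_betw_finite_nat[of "UNIV :: 'n set"] by (auto simp: atLeast0LessThan)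
  define B where "B = Suc (\<Sum>\<alpha>\<in>M. sum \<alpha> UNIV)"
  have bound: "\<alpha> i < B" if "\<alpha> \<in> M" for \<alpha> i
  proof -
    have "\<alpha> i \<le> sum \<alpha> UNIV"
      by (rule exponent_le_sum)
    also have "\<dots> \<le> (\<Sum>\<alpha>\<in>M. sum \<alpha> UNIV)"
      using member_le_sum[of \<alpha> M "\<lambda>\<alpha>. sum \<alpha> UNIV"] that assms by simp
    finally show ?thesis
      by (simp add: B_def)
  qed
  define g where "g = inv_into UNIV h"
  have g: "g (h i) = i" for i
    using h by (simp add: g_def bij_betw_def)
  have reindex: "(\<Sum>i\<in>UNIV. B ^ h i * \<alpha> i) = (\<Sum>k<CARD('n). \<alpha> (g k) * B ^ k)" for \<alpha> :: "'n \<Rightarrow> nat"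
    using sum.reindex_bij_betw[OF h, of "\<lambda>k. \<alpha> (g k) * B ^ k"] by (simp add: g mult.commute)
  have "inj_on (\<lambda>\<alpha>. \<Sum>i\<in>UNIV. B ^ h i * \<alpha> i) M"
  proof (rule inj_onI)
    fix \<alpha> \<beta> :: "'n \<Rightarrow> nat"
    assume M: "\<alpha> \<in> M" "\<beta> \<in> M" and eq: "(\<Sum>i\<in>UNIV. B ^ h i * \<alpha> i) = (\<Sum>i\<in>UNIV. B ^ h i * \<beta> i)"
    have "\<forall>k<CARD('n). \<alpha> (g k) = \<beta> (g k)"
      using eq unfolding reindex by (intro digits_unique[where B = B]) (auto simp: bound M)
    moreover have "h i < CARD('n)" for i
      using h by (auto simp: bij_betw_def)
    ultimately have "\<alpha> i = \<beta> i" for i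
      using g by metis
    then show "\<alpha> = \<beta>" by auto
  qed
  then show ?thesis
    by (intro that[of "\<lambda>i. B ^ h i"])
qed

lemma poly_eq_on_infinite:
  fixes p r :: "'k::idom poly"
  assumes "infinite S" and "\<And>x. x \<in> S \<Longrightarrow> poly p x = poly r x"
  shows "p = r"
proof (rule ccontr)
  assume "p \<noteq> r"
  then have "finite {x. poly (p - r) x = 0}"
    by (intro poly_roots_finite) simp
  moreover have "S \<subseteq> {x. poly (p - r) x = 0}"
    using assms by auto
  ultimately show False
    using assms finite_subset by blast
qed

text \<open>Coefficients stay in the image of the finite field, which keeps the spaces
  \<open>pols\<close> finite; only the arguments range over \<open>'k\<close>. Asking for a domain
  admits the polynomial ring over \<open>'a\<close>, with \<open>emb\<close> the constants.\<close>

locale finite_subfield =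
  fixes emb :: "'a::{field,finite} \<Rightarrow> 'k::idom"
  assumes emb_add: "emb (a + b) = emb a + emb b"
    and emb_mult: "emb (a * b) = emb a * emb b"
    and emb_1 [simp]: "emb 1 = 1"
    and infinite_big_field: "infinite (UNIV :: 'k set)"
begin

lemma emb_0 [simp]: "emb 0 = 0"
proof -
  have "emb 0 + emb 0 = emb 0 + 0"
    using emb_add[of 0 0] by simp
  then show ?thesis
    by (rule add_left_imp_eq)
qed

lemma emb_minus: "emb (- a) = - emb a"
  using emb_add[of a "- a"] by (simp add: add_eq_0_iff)

lemma emb_diff: "emb (a - b) = emb a - emb b"
  using emb_add[of a "- b"] by (simp add: emb_minus)

lemma emb_eq_0_iff [simp]: "emb a = 0 \<longleftrightarrow> a = 0"
proof
  assume "emb a = 0"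
  then have "emb (a * inverse a) = 0"
    by (simp add: emb_mult)
  then show "a = 0"
    by (cases "a = 0") auto
qed simp

lemma emb_eq_iff [simp]: "emb a = emb b \<longleftrightarrow> a = b"
  using emb_eq_0_iff[of "a - b"] by (simp add: emb_diff del: emb_eq_0_iff)

lemma emb_sum: "emb (sum f S) = (\<Sum>x\<in>S. emb (f x))"
  by (induction S rule: infinite_finite_induct) (auto simp: emb_add)

definition pols :: "('n::finite \<Rightarrow> nat) set \<Rightarrow> (('n \<Rightarrow> 'k) \<Rightarrow> 'k) set" where
  "pols M = range (\<lambda>c x. \<Sum>\<alpha>\<in>M. emb (c \<alpha>) * monomial \<alpha> x)"

lemma pols_zero [simp]: "(\<lambda>x. 0) \<in> pols M"
  unfolding pols_def by (rule range_eqI[of _ _ "\<lambda>_. 0"]) simp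

lemma polsI: "f = (\<lambda>x. \<Sum>\<alpha>\<in>M. emb (c \<alpha>) * monomial \<alpha> x) \<Longrightarrow> f \<in> pols M"
  by (auto simp: pols_def)

lemma polsE:
  assumes "f \<in> pols M"
  obtains c where "f = (\<lambda>x. \<Sum>\<alpha>\<in>M. emb (c \<alpha>) * monomial \<alpha> x)"
  using assms by (auto simp: pols_def)

lemma pols_diff:
  assumes "f \<in> pols M" "g \<in> pols M"
  shows "(\<lambda>x. f x - g x) \<in> pols M"
proof -
  obtain c d where "f = (\<lambda>x. \<Sum>\<alpha>\<in>M. emb (c \<alpha>) * monomial \<alpha> x)"
    "g = (\<lambda>x. \<Sum>\<alpha>\<in>M. emb (d \<alpha>) * monomial \<alpha> x)"
    using assms by (elim polsE)
  then show ?thesis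
    by (intro polsI[where c = "\<lambda>\<alpha>. c \<alpha> - d \<alpha>"]) (simp add: emb_diff left_diff_distrib sum_subtractf)
qed

lemma pols_scale:
  assumes "f \<in> pols M"
  shows "(\<lambda>x. emb c * f x) \<in> pols M"
proof -
  obtain d where "f = (\<lambda>x. \<Sum>\<alpha>\<in>M. emb (d \<alpha>) * monomial \<alpha> x)"
    using assms by (elim polsE)
  then show ?thesis
    by (intro polsI[where c = "\<lambda>\<alpha>. c * d \<alpha>"]) (simp add: emb_mult sum_distrib_left mult.assoc)
qed

lemma pols_add: "f \<in> pols M \<Longrightarrow> g \<in> pols M \<Longrightarrow> (\<lambda>x. f x + g x) \<in> pols M"
  using pols_diff[of f M "\<lambda>x. 0 - g x"] pols_diff[of "\<lambda>x. 0" M g] by simp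

lemma pols_sum: "(\<And>j. j \<in> J \<Longrightarrow> f j \<in> pols M) \<Longrightarrow> (\<lambda>x. \<Sum>j\<in>J. f j x) \<in> pols M"
  by (induction J rule: infinite_finite_induct) (auto intro: pols_add)

lemma pols_monomial:
  assumes "finite M" "\<alpha> \<in> M"
  shows "monomial \<alpha> \<in> pols M"
  unfolding pols_def
proof (rule range_eqI[of _ _ "\<lambda>\<beta>. if \<beta> = \<alpha> then 1 else 0"], rule ext)
  fix x
  have "(\<Sum>\<beta>\<in>M. emb (if \<beta> = \<alpha> then 1 else 0) * monomial \<beta> x) = (\<Sum>\<beta>\<in>M. if \<beta> = \<alpha> then monomial \<beta> x else 0)"
    by (intro sum.cong) auto
  then show "monomial \<alpha> x = (\<Sum>\<beta>\<in>M. emb (if \<beta> = \<alpha> then 1 else 0) * monomial \<beta> x)"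
    using assms by simp
qed

lemma pols_induct [consumes 1, case_names zero add scale]:
  assumes "f \<in> pols M"
    and "P (\<lambda>x. 0)" and "\<And>f g. P f \<Longrightarrow> P g \<Longrightarrow> P (\<lambda>x. f x + g x)"
    and "\<And>c \<alpha>. \<alpha> \<in> M \<Longrightarrow> P (\<lambda>x. emb c * monomial \<alpha> x)"
  shows "P f"
proof -
  obtain c where c: "f = (\<lambda>x. \<Sum>\<alpha>\<in>M. emb (c \<alpha>) * monomial \<alpha> x)"
    using assms(1) by (auto simp: pols_def)
  have "P (\<lambda>x. \<Sum>\<alpha>\<in>N. emb (c \<alpha>) * monomial \<alpha> x)" if "N \<subseteq> M" for N
    using that by (induction N rule: infinite_finite_induct) (auto intro: assms)
  then show ?thesis
    by (simp add: c)
qed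

lemma pols_mono:
  assumes "f \<in> pols M" "M \<subseteq> N" "finite N"
  shows "f \<in> pols N"
  using assms(1)
  by (induction rule: pols_induct) (use assms in \<open>auto intro!: pols_add pols_scale pols_monomial\<close>)

lemma pols_mult:
  assumes "f \<in> pols A" "g \<in> pols B" "finite C" "\<And>\<alpha> \<beta>. \<alpha> \<in> A \<Longrightarrow> \<beta> \<in> B \<Longrightarrow> \<alpha> + \<beta> \<in> C"
  shows "(\<lambda>x. f x * g x) \<in> pols C"
  using assms(1)
proof (induction rule: pols_induct)
  case (scale c \<alpha>)
  show ?case
    using assms(2)
  proof (induction rule: pols_induct)
    case (scale d \<beta>)
    have "(\<lambda>x. emb (c * d) * monomial (\<alpha> + \<beta>) x) \<in> pols C"
      using assms \<open>\<alpha> \<in> A\<close> \<open>\<beta> \<in> B\<close> by (intro pols_scale pols_monomial) auto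
    then show ?case
      by (simp add: emb_mult monomial_add mult_ac)
  qed (auto simp: distrib_left intro: pols_add)
qed (auto simp: distrib_right intro: pols_add)

text \<open>Substituting \<open>z ^ w i\<close> for \<open>x i\<close> with Kronecker weights gives
  a univariate polynomial with the same coefficients and infinitely many roots. Taking z nonzero
  confines the test to points without zero coordinates, so that later arguments may assume a line
  direction \<open>v\<close> with all \<open>v i\<close> nonzero.\<close>

lemma monomials_independent:
  assumes "finite M"
    and "\<And>x :: 'n::finite \<Rightarrow> 'k. (\<And>i. x i \<noteq> 0) \<Longrightarrow> (\<Sum>\<alpha>\<in>M. c \<alpha> * monomial \<alpha> x) = 0"
  shows "\<forall>\<alpha>\<in>M. c \<alpha> = 0"
proof -
  obtain w :: "'n \<Rightarrow> nat" where w: "inj_on (\<lambda>\<alpha>. \<Sum>i\<in>UNIV. w i * \<alpha> i) M"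
    using kronecker_weights[OF assms(1)] .
  define N where "N \<alpha> = (\<Sum>i\<in>UNIV. w i * \<alpha> i)" for \<alpha>
  have N: "inj_on N M"
    using w by (simp add: N_def [abs_def])
  define p where "p = (\<Sum>\<alpha>\<in>M. monom (c \<alpha>) (N \<alpha>))"
  have "p = 0"
  proof (rule poly_eq_on_infinite)
    show "infinite (UNIV - {0 :: 'k})"
      using infinite_big_field by simp
    fix z :: 'k assume z: "z \<in> UNIV - {0}"
    have "monomial \<alpha> (\<lambda>i. z ^ w i) = z ^ N \<alpha>" for \<alpha> :: "'n \<Rightarrow> nat"
      by (simp add: monomial_def N_def power_sum power_mult)
    then show "poly p z = poly 0 z"
      using assms(2)[of "\<lambda>i. z ^ w i"] z by (simp add: p_def poly_sum poly_monom)
  qed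
  show ?thesis
  proof
    fix \<beta> assume "\<beta> \<in> M"
    have "0 = coeff p (N \<beta>)"
      by (simp add: \<open>p = 0\<close>)
    also have "\<dots> = (\<Sum>\<alpha>\<in>M. if \<alpha> = \<beta> then c \<alpha> else 0)"
      unfolding p_def coeff_sum coeff_monom
      by (intro sum.cong) (use N \<open>\<beta> \<in> M\<close> in \<open>auto simp: inj_on_def\<close>)
    also have "\<dots> = c \<beta>"
      using \<open>\<beta> \<in> M\<close> assms(1) by simp
    finally show "c \<beta> = 0" by simp
  qed
qed

lemma card_pols:
  assumes "finite M"
  shows "finite (pols M)" "card (pols M) = CARD('a) ^ card M"
proof -
  define ev where "ev c = (\<lambda>x. \<Sum>\<alpha>\<in>M. emb (c \<alpha>) * monomial \<alpha> x)" for c :: "('b \<Rightarrow> nat) \<Rightarrow> 'a"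
  have eq: "pols M = ev ` PiE M (\<lambda>_. UNIV)"
  proof
    show "pols M \<subseteq> ev ` PiE M (\<lambda>_. UNIV)"
    proof
      fix f assume "f \<in> pols M"
      then obtain c where "f = ev c"
        by (auto simp: pols_def ev_def)
      then have "f = ev (restrict c M)"
        by (auto simp: ev_def)
      then show "f \<in> ev ` PiE M (\<lambda>_. UNIV)"
        by (intro image_eqI[of _ _ "restrict c M"]) auto
    qed
  qed (auto simp: pols_def ev_def)
  have inj: "inj_on ev (PiE M (\<lambda>_. UNIV))"
  proof (rule inj_onI)
    fix c d assume cd: "c \<in> PiE M (\<lambda>_. UNIV)" "d \<in> PiE M (\<lambda>_. UNIV)" "ev c = ev d"
    have "\<forall>\<alpha>\<in>M. emb (c \<alpha>) - emb (d \<alpha>) = 0"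
    proof (rule monomials_independent[OF assms])
      fix x :: "'b \<Rightarrow> 'k"
      show "(\<Sum>\<alpha>\<in>M. (emb (c \<alpha>) - emb (d \<alpha>)) * monomial \<alpha> x) = 0"
        using fun_cong[OF cd(3), of x] by (simp add: ev_def left_diff_distrib sum_subtractf)
    qed
    then show "c = d"
      using cd by (intro PiE_ext) auto
  qed
  show "finite (pols M)"
    unfolding eq using assms by (simp add: finite_PiE)
  show "card (pols M) = CARD('a) ^ card M"
    unfolding eq by (simp add: card_image[OF inj] card_PiE assms)
qed

end

section \<open>Multiplicities along lines\<close>

lemma coeff_mult_degree_le:
  fixes p r :: "'k::idom poly"
  assumes "degree p \<le> a" "degree r \<le> b"
  shows "coeff (p * r) (a + b) = coeff p a * coeff r b"
proof (cases "degree p = a \<and> degree r = b")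
  case True
  then show ?thesis
    using coeff_mult_degree_sum[of p r] by simp
next
  case False
  then have "degree p < a \<or> degree r < b"
    using assms by auto
  moreover from this have "degree (p * r) < a + b"
    using assms degree_mult_le[of p r] by auto
  ultimately show ?thesis
    by (auto simp: coeff_eq_0)
qed

text \<open>For polynomials on a plane the outer variable t is transversal to a line and the inner
  variable s runs along it: \<open>coeff Q i\<close> is the coefficient of t^i, a polynomial in s,
  and the value is \<open>poly (poly Q [:t:]) s\<close>.\<close>

definition total_degree_le :: "nat \<Rightarrow> 'k::idom poly poly \<Rightarrow> bool" where
  "total_degree_le d Q \<longleftrightarrow> (\<forall>i j. coeff (coeff Q i) j \<noteq> 0 \<longrightarrow> i + j \<le> d)"

text \<open>Order at least m at the point s = c, t = 0. Truncated subtraction leaves the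
  coefficients of t^i with i \<ge> m free.\<close>

definition vanishing_weight_ge :: "'k::idom \<Rightarrow> nat \<Rightarrow> 'k poly poly \<Rightarrow> bool" where
  "vanishing_weight_ge c m Q \<longleftrightarrow> (\<forall>i. [:- c, 1:] ^ (m - i) dvd coeff Q i)"

lemma total_degree_le_mult:
  assumes "total_degree_le a P" "total_degree_le b Q"
  shows "total_degree_le (a + b) (P * Q)"
  unfolding total_degree_le_def
proof (intro allI impI)
  fix i j assume "coeff (coeff (P * Q) i) j \<noteq> 0"
  then have "(\<Sum>k\<le>i. coeff (coeff P k * coeff Q (i - k)) j) \<noteq> 0"
    by (simp add: coeff_mult[of P] coeff_sum)
  then obtain k where k: "k \<le> i" "coeff (coeff P k * coeff Q (i - k)) j \<noteq> 0"
    by (auto elim: sum.not_neutral_contains_not_neutral)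
  then obtain l where "l \<le> j" "coeff (coeff P k) l * coeff (coeff Q (i - k)) (j - l) \<noteq> 0"
    by (auto simp: coeff_mult elim: sum.not_neutral_contains_not_neutral)
  then have "k + l \<le> a" "(i - k) + (j - l) \<le> b" "l \<le> j"
    using assms unfolding total_degree_le_def mult_eq_0_iff by blast+
  then show "i + j \<le> a + b"
    using k by linarith
qed

lemma vanishing_weight_ge_mult:
  assumes "vanishing_weight_ge c a P" "vanishing_weight_ge c b Q"
  shows "vanishing_weight_ge c (a + b) (P * Q)"
  unfolding vanishing_weight_ge_def
proof
  fix i
  have "[:- c, 1:] ^ (a + b - i) dvd coeff P k * coeff Q (i - k)" if "k \<le> i" for k
  proof -
    have "[:- c, 1:] ^ (a + b - i) dvd [:- c, 1:] ^ ((a - k) + (b - (i - k)))"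
      using that by (intro le_imp_power_dvd) linarith
    also have "\<dots> dvd coeff P k * coeff Q (i - k)"
      using assms unfolding vanishing_weight_ge_def power_add by (intro mult_dvd_mono) auto
    finally show ?thesis .
  qed
  then show "[:- c, 1:] ^ (a + b - i) dvd coeff (P * Q) i"
    unfolding coeff_mult by (intro dvd_sum) auto
qed

text \<open>\<open>R\<close> abstracts a multiplicative filtration, so that
  \<open>total_degree_le\<close> and \<open>vanishing_weight_ge c\<close> share one argument for
  products of linear forms.\<close>

lemma graded_power:
  fixes L :: "'b::comm_monoid_mult"
  assumes "R 0 1" "\<And>a b P Q. R a P \<Longrightarrow> R b Q \<Longrightarrow> R (a + b) (P * Q)" "R 1 L"
  shows "R k (L ^ k)"
proof (induction k)
  case (Suc k)
  show ?case
    using assms(2)[OF assms(3) Suc] by simp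
qed (use assms in simp)

lemma graded_prod:
  fixes L :: "'n::finite \<Rightarrow> 'b::comm_monoid_mult" and \<alpha> :: "'n \<Rightarrow> nat"
  assumes "R 0 1" "\<And>a b P Q. R a P \<Longrightarrow> R b Q \<Longrightarrow> R (a + b) (P * Q)" "\<And>i. R 1 (L i)"
  shows "R (sum \<alpha> UNIV) (\<Prod>i\<in>UNIV. L i ^ \<alpha> i)"
proof -
  have "R (sum \<alpha> A) (\<Prod>i\<in>A. L i ^ \<alpha> i)" if "finite A" for A
    using that
    by (induction A rule: finite_induct) (auto intro!: assms(2) graded_power[of R] assms)
  then show ?thesis by simp
qed

context finite_subfield
begin

lemma pols_exponents_mono: "f \<in> pols (exponents m d) \<Longrightarrow> m' \<le> m \<Longrightarrow> d \<le> d' \<Longrightarrow> f \<in> pols (exponents m' d')"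
  by (erule pols_mono) (auto simp: exponents_iff)

lemma pols_exponents_mult:
  "f \<in> pols (exponents a b) \<Longrightarrow> g \<in> pols (exponents c d) \<Longrightarrow>
    (\<lambda>x. f x * g x) \<in> pols (exponents (a + c) (b + d))"
  by (erule (1) pols_mult) (auto simp: exponents_iff sum.distrib)

lemma pols_const: "(\<lambda>x. emb c) \<in> pols (exponents 0 d)"
proof -
  have "(\<lambda>x. emb c * monomial 0 x) \<in> pols (exponents 0 d)"
    by (intro pols_scale pols_monomial) (auto simp: exponents_iff)
  then show ?thesis by simp
qed

lemma monomial_unit: "monomial (\<lambda>j. if j = i then k else 0) x = x i ^ k"
proof -
  have "monomial (\<lambda>j. if j = i then k else 0) x = (\<Prod>j\<in>UNIV. if j = i then x j ^ k else 1)"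
    unfolding monomial_def by (intro prod.cong) auto
  then show ?thesis by simp
qed

lemma pols_coordinate: "(\<lambda>x. x i) \<in> pols (exponents 1 1)"
  using pols_monomial[of "exponents 1 1" "\<lambda>j. if j = i then 1 else 0"]
  by (simp add: monomial_unit [abs_def] exponents_iff)

lemma pols_substitute:
  fixes f :: "('n::finite \<Rightarrow> 'k) \<Rightarrow> 'k" and L :: "'n \<Rightarrow> ('m::finite \<Rightarrow> 'k) \<Rightarrow> 'k"
  assumes "f \<in> pols (exponents m d)" and L: "\<And>i. L i \<in> pols (exponents a b)"
  shows "(\<lambda>x. f (\<lambda>i. L i x)) \<in> pols (exponents (a * m) (b * d))"
  using assms(1)
proof (induction rule: pols_induct)
  case (scale c \<alpha>)
  have power: "(\<lambda>x. L i x ^ k) \<in> pols (exponents (a * k) (b * k))" for i k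
  proof (induction k)
    case 0
    show ?case using pols_const[of 1 0] by simp
  next
    case (Suc k)
    show ?case using pols_exponents_mult[OF L Suc] by simp
  qed
  have "(\<lambda>x. \<Prod>i\<in>A. L i x ^ \<alpha> i) \<in> pols (exponents (a * sum \<alpha> A) (b * sum \<alpha> A))" if "finite A" for A
    using that
  proof (induction A rule: finite_induct)
    case empty
    show ?case using pols_const[of 1 0] by simp
  next
    case (insert i A)
    then show ?case
      using pols_exponents_mult[OF power[of i "\<alpha> i"] insert.IH] by (simp add: distrib_left)
  qed
  from this[of UNIV] have "(\<lambda>x. monomial \<alpha> (\<lambda>i. L i x)) \<in> pols (exponents (a * sum \<alpha> UNIV) (b * sum \<alpha> UNIV))"
    by (simp add: monomial_def)
  then show ?case
    using scale by (intro pols_scale) (erule pols_exponents_mono, auto simp: exponents_iff)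
qed (auto intro: pols_add)

section \<open>Multiplicity at a point\<close>

definition embv :: "'a ^ 'n::finite \<Rightarrow> 'n \<Rightarrow> 'k" where
  "embv u = (\<lambda>i. emb (u $ i))"

lemma pols_translate:
  assumes "f \<in> pols (exponents 0 d)"
  shows "(\<lambda>y. f (embv u + y)) \<in> pols (exponents 0 d)"
proof -
  have "(\<lambda>y. emb (u $ i) + y i) \<in> pols (exponents 0 1)" for i
    using pols_coordinate[of i] by (intro pols_add pols_const) (rule pols_exponents_mono, auto)
  from pols_substitute[OF assms this] show ?thesis
    by (simp add: embv_def plus_fun_def)
qed

text \<open>The Taylor expansion at u has no term of degree below m. Derivatives are avoided because
  ordinary ones do not detect multiplicity in positive characteristic.\<close>

definition vanishes :: "nat \<Rightarrow> (('n::finite \<Rightarrow> 'k) \<Rightarrow> 'k) \<Rightarrow> 'a ^ 'n \<Rightarrow> bool" where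
  "vanishes m f u \<longleftrightarrow> (\<exists>d. (\<lambda>y. f (embv u + y)) \<in> pols (exponents m d))"

lemma vanishes_zero: "vanishes m (\<lambda>x. 0) u"
  by (auto simp: vanishes_def)

lemma vanishes_diff:
  assumes "vanishes m f u" "vanishes m g u"
  shows "vanishes m (\<lambda>x. f x - g x) u"
proof -
  obtain d d' where "(\<lambda>y. f (embv u + y)) \<in> pols (exponents m d)"
    "(\<lambda>y. g (embv u + y)) \<in> pols (exponents m d')"
    using assms by (auto simp: vanishes_def)
  then have "(\<lambda>y. f (embv u + y)) \<in> pols (exponents m (max d d'))"
    "(\<lambda>y. g (embv u + y)) \<in> pols (exponents m (max d d'))"
    by (auto elim!: pols_exponents_mono)
  then show ?thesis
    using pols_diff by (auto simp: vanishes_def)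
qed

lemma vanishes_subgroup:
  "additive_subgroup {f \<in> pols M. vanishes m f u}" "additive_subgroup {f. vanishes m f u}"
  using vanishes_diff[of m _ u] vanishes_zero[of m u] pols_diff[of _ M] pols_zero[of M]
  unfolding additive_subgroup_def fun_diff_def zero_fun_def by auto

text \<open>Translation carries order m at 0 to order m at u without raising the degree, so at most
  the monomials of degree below m are lost.\<close>

lemma card_pols_le_vanishing:
  fixes u :: "'a ^ 'n::finite"
  shows "card (pols (exponents 0 d) :: (('n \<Rightarrow> 'k) \<Rightarrow> 'k) set) \<le>
    CARD('a) ^ card {\<alpha>::'n \<Rightarrow> nat. sum \<alpha> UNIV < m} *
    card {f \<in> pols (exponents 0 d). vanishes m f u}"
proof -
  define H where "H = pols (exponents m d :: ('n \<Rightarrow> nat) set)"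
  define low where "low = {\<alpha>::'n \<Rightarrow> nat. sum \<alpha> UNIV < m}"
  have "finite low"
    by (rule finite_subset[OF _ finite_exponents[of 0 m]]) (auto simp: low_def exponents_iff)
  have fin: "finite {f \<in> pols (exponents 0 d). vanishes m f u}"
    by (simp add: card_pols)
  have "card H \<le> card {f \<in> pols (exponents 0 d). vanishes m f u}"
  proof (rule card_inj_on_le[where f = "\<lambda>f x. f (embv (- u) + x)"])
    show "inj_on (\<lambda>f x. f (embv (- u) + x)) H"
    proof (rule inj_onI)
      fix f g :: "('n \<Rightarrow> 'k) \<Rightarrow> 'k"
      assume eq: "(\<lambda>x. f (embv (- u) + x)) = (\<lambda>x. g (embv (- u) + x))"
      have "f y = g y" for y
        using fun_cong[OF eq, of "y - embv (- u)"] by simp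
      then show "f = g" by auto
    qed
    show "(\<lambda>f x. f (embv (- u) + x)) ` H \<subseteq> {f \<in> pols (exponents 0 d). vanishes m f u}"
    proof (rule image_subsetI)
      fix f assume f: "f \<in> H"
      have "(\<lambda>y. f (embv (- u) + (embv u + y))) = f"
        by (simp add: embv_def emb_minus plus_fun_def)
      then have "vanishes m (\<lambda>x. f (embv (- u) + x)) u"
        using f unfolding vanishes_def H_def by metis
      moreover have "f \<in> pols (exponents 0 d)"
        using f by (auto simp: H_def elim: pols_exponents_mono)
      ultimately show "(\<lambda>x. f (embv (- u) + x)) \<in> {f \<in> pols (exponents 0 d). vanishes m f u}"
        by (auto intro: pols_translate)
    qed
  qed (rule fin)
  moreover have "card (exponents 0 d :: ('n \<Rightarrow> nat) set) \<le> card low + card (exponents m d :: ('n \<Rightarrow> nat) set)"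
  proof -
    have "card (exponents 0 d :: ('n \<Rightarrow> nat) set) \<le> card (low \<union> exponents m d)"
      using \<open>finite low\<close> by (intro card_mono) (auto simp: low_def exponents_iff)
    then show ?thesis
      using card_Un_le[of low "exponents m d"] by linarith
  qed
  then have "CARD('a) ^ card (exponents 0 d :: ('n \<Rightarrow> nat) set) \<le> CARD('a) ^ card low * card H"
    unfolding H_def card_pols(2)[OF finite_exponents] power_add[symmetric]
    by (intro power_increasing) (auto simp: Suc_le_eq card_gt_0_iff)
  ultimately show ?thesis
    unfolding card_pols(2)[OF finite_exponents] low_def[symmetric]
    by (meson le_trans mult_le_mono2)
qed

text \<open>Along u + t v the coefficient of t^e is the degree-e part of the Taylor expansion at u,
  evaluated at v. If it is 0 for all v without zero coordinates, that part is 0 by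
  \<open>monomials_independent\<close>.\<close>

lemma vanishes_if_on_lines:
  assumes f: "f \<in> pols (exponents 0 d)"
    and lines: "\<And>v. (\<And>i. v i \<noteq> 0) \<Longrightarrow> \<exists>p. \<forall>t. f (\<lambda>i. embv u i + t * v i) = t ^ l * poly p t"
  shows "vanishes l f u"
proof -
  obtain c where c: "(\<lambda>y. f (embv u + y)) = (\<lambda>y. \<Sum>\<alpha>\<in>exponents 0 d. emb (c \<alpha>) * monomial \<alpha> y)"
    using pols_translate[OF f, of u] by (elim polsE)
  \<comment> \<open>Degree e may exceed d, hence the padding of \<open>c\<close> by 0.\<close>
  have "\<forall>\<alpha>\<in>exponents e e. emb (if \<alpha> \<in> exponents 0 d then c \<alpha> else 0) = 0" if "e < l" for e
  proof (rule monomials_independent)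
    fix v :: "'b \<Rightarrow> 'k" assume "\<And>i. v i \<noteq> 0"
    then obtain p where p: "\<And>t. f (\<lambda>i. embv u i + t * v i) = t ^ l * poly p t"
      using lines by blast
    define P where "P = (\<Sum>\<alpha>\<in>exponents 0 d. monom (emb (c \<alpha>) * monomial \<alpha> v) (sum \<alpha> UNIV))"
    have "P = monom 1 l * p"
    proof (rule poly_eq_on_infinite[OF infinite_big_field])
      fix t
      have "poly P t = (\<Sum>\<alpha>\<in>exponents 0 d. emb (c \<alpha>) * monomial \<alpha> (\<lambda>i. t * v i))"
        by (simp add: P_def poly_sum poly_monom monomial_scale mult_ac)
      also have "\<dots> = f (\<lambda>i. embv u i + t * v i)"
        using fun_cong[OF c, of "\<lambda>i. t * v i"] by (simp add: plus_fun_def)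
      finally show "poly P t = poly (monom 1 l * p) t"
        by (simp add: p poly_monom)
    qed
    then have "coeff P e = 0"
      using that by (simp add: coeff_monom_mult)
    also have "coeff P e = (\<Sum>\<alpha>\<in>exponents 0 d. if sum \<alpha> UNIV = e then emb (c \<alpha>) * monomial \<alpha> v else 0)"
      by (simp add: P_def coeff_sum)
    also have "\<dots> = (\<Sum>\<alpha>\<in>exponents e e. emb (if \<alpha> \<in> exponents 0 d then c \<alpha> else 0) * monomial \<alpha> v)"
      by (intro sum.mono_neutral_cong) (auto simp: exponents_iff)
    finally show "(\<Sum>\<alpha>\<in>exponents e e. emb (if \<alpha> \<in> exponents 0 d then c \<alpha> else 0) * monomial \<alpha> v) = 0" .
  qed simp
  then have zero: "c \<alpha> = 0" if "\<alpha> \<in> exponents 0 d" "sum \<alpha> UNIV < l" for \<alpha>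
    using that by (force simp: exponents_iff)
  have "(\<lambda>y. f (embv u + y)) = (\<lambda>y. \<Sum>\<alpha>\<in>exponents l d. emb (c \<alpha>) * monomial \<alpha> y)"
    unfolding c by (intro ext sum.mono_neutral_right) (auto simp: exponents_iff zero not_le)
  then show ?thesis
    unfolding vanishes_def by (intro exI[of _ d] polsI)
qed

section \<open>Restriction to planes and lines\<close>

lemma bivariate_unique:
  fixes P Q :: "'k poly poly"
  assumes "\<And>s t. poly (poly P [:t:]) s = poly (poly Q [:t:]) s"
  shows "P = Q"
proof (rule poly_eq_on_infinite)
  show "infinite (range (\<lambda>t::'k. [:t:]))"
    using infinite_big_field by (simp add: finite_image_iff inj_on_def)
  show "poly P x = poly Q x" if "x \<in> range (\<lambda>t. [:t:])" for x
    using that assms by (auto intro: poly_eq_on_infinite[OF infinite_big_field])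
qed

lemma poly_bivariate_monomial:
  "poly (poly (\<Prod>i\<in>UNIV. [:A i, [:B i:]:] ^ \<alpha> i) [:t:]) s = monomial \<alpha> (\<lambda>i. poly (A i) s + t * B i)"
  by (simp add: monomial_def poly_prod poly_power mult.commute)

lemma pols_bivariate:
  assumes "f \<in> pols (exponents 0 d)"
  obtains Q where "total_degree_le d Q"
    "\<And>s t. f (\<lambda>i. a i + s * u i + t * v i) = poly (poly Q [:t:]) s"
proof -
  have "\<exists>Q. total_degree_le d Q \<and> (\<forall>s t. f (\<lambda>i. a i + s * u i + t * v i) = poly (poly Q [:t:]) s)"
    using assms
  proof (induction rule: pols_induct)
    case zero
    show ?case by (intro exI[of _ 0]) (simp add: total_degree_le_def)
  next
    case (add f g)
    then obtain P Q where "total_degree_le d P" "\<forall>s t. f (\<lambda>i. a i + s * u i + t * v i) = poly (poly P [:t:]) s"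
      "total_degree_le d Q" "\<forall>s t. g (\<lambda>i. a i + s * u i + t * v i) = poly (poly Q [:t:]) s"
      by auto
    then show ?case
      by (intro exI[of _ "P + Q"]) (auto simp: total_degree_le_def, metis add_cancel_right_right)
  next
    case (scale c \<alpha>)
    define Q where "Q = (\<Prod>i\<in>UNIV. [:[:a i, u i:], [:v i:]:] ^ \<alpha> i)"
    have "total_degree_le (sum \<alpha> UNIV) Q"
      unfolding Q_def
    proof (rule graded_prod[of total_degree_le])
      show "total_degree_le 0 (1 :: 'k poly poly)"
        by (auto simp: total_degree_le_def split: if_splits simp flip: one_pCons)
      show "total_degree_le 1 [:[:a i, u i:], [:v i:]:]" for i
        by (auto simp: total_degree_le_def coeff_pCons split: nat.splits)
    qed (rule total_degree_le_mult)
    then have "total_degree_le d (smult [:emb c:] Q)"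
      using scale by (auto simp: total_degree_le_def exponents_iff intro: le_trans)
    then show ?case
      using poly_bivariate_monomial[of "\<lambda>i. [:a i, u i:]" v \<alpha>]
      by (intro exI[of _ "smult [:emb c:] Q"]) (simp add: Q_def algebra_simps)
  qed
  then show ?thesis
    using that by blast
qed

text \<open>\<open>f\<close> is meant to be already expanded at the point of the line with parameter
  c: each coordinate (s - c) u_i + t v_i then has weight 1 at s = c, t = 0, and a monomial has at
  least the weight of its degree.\<close>

lemma pols_bivariate_vanishing:
  assumes "f \<in> pols (exponents m d)"
  obtains Q where "vanishing_weight_ge c m Q"
    "\<And>s t. f (\<lambda>i. (s - c) * u i + t * v i) = poly (poly Q [:t:]) s"
proof -
  have "\<exists>Q. vanishing_weight_ge c m Q \<and> (\<forall>s t. f (\<lambda>i. (s - c) * u i + t * v i) = poly (poly Q [:t:]) s)"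
    using assms
  proof (induction rule: pols_induct)
    case zero
    show ?case by (intro exI[of _ 0]) (simp add: vanishing_weight_ge_def)
  next
    case (add f g)
    then obtain P Q where
      "vanishing_weight_ge c m P" "\<forall>s t. f (\<lambda>i. (s - c) * u i + t * v i) = poly (poly P [:t:]) s"
      "vanishing_weight_ge c m Q" "\<forall>s t. g (\<lambda>i. (s - c) * u i + t * v i) = poly (poly Q [:t:]) s"
      by auto
    then show ?case
      by (intro exI[of _ "P + Q"]) (auto simp: vanishing_weight_ge_def)
  next
    case (scale e \<alpha>)
    define Q where "Q = (\<Prod>i\<in>UNIV. [:smult (u i) [:- c, 1:], [:v i:]:] ^ \<alpha> i)"
    have "vanishing_weight_ge c (sum \<alpha> UNIV) Q"
      unfolding Q_def
    proof (rule graded_prod[of "vanishing_weight_ge c"])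
      show "vanishing_weight_ge c 0 1"
        by (simp add: vanishing_weight_ge_def)
      show "vanishing_weight_ge c 1 [:smult (u i) [:- c, 1:], [:v i:]:]" for i
        unfolding vanishing_weight_ge_def
      proof
        fix j
        show "[:- c, 1:] ^ (1 - j) dvd coeff [:smult (u i) [:- c, 1:], [:v i:]:] j"
          by (cases j) (simp_all del: smult_pCons add: dvd_smult)
      qed
    qed (rule vanishing_weight_ge_mult)
    moreover have "m \<le> sum \<alpha> UNIV"
      using scale by (simp add: exponents_iff)
    ultimately have "[:- c, 1:] ^ (m - j) dvd coeff Q j" for j
      unfolding vanishing_weight_ge_def by (meson diff_le_mono dvd_trans le_imp_power_dvd)
    then have "vanishing_weight_ge c m (smult [:emb e:] Q)"
      by (auto simp: vanishing_weight_ge_def intro: dvd_smult)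
    then show ?case
      using poly_bivariate_monomial[of "\<lambda>i. smult (u i) [:- c, 1:]" v \<alpha>]
      by (intro exI[of _ "smult [:emb e:] Q"]) (simp add: Q_def algebra_simps)
  qed
  then show ?thesis
    using that by blast
qed

text \<open>For a form (\<open>m = d\<close>) the coefficient of s^d depends on the direction
  \<open>w\<close> and not on the base point \<open>a\<close>. It is the value at infinity through
  which \<open>vanishes_at_direction\<close> reaches the form.\<close>

lemma pols_univariate:
  assumes "f \<in> pols (exponents m d)"
  obtains p where "degree p \<le> d" "\<And>s. f (\<lambda>i. a i + s * w i) = poly p s"
    "m = d \<Longrightarrow> coeff p d = f w"
proof -
  have "\<exists>p. degree p \<le> d \<and> (\<forall>s. f (\<lambda>i. a i + s * w i) = poly p s) \<and> (m = d \<longrightarrow> coeff p d = f w)"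
    using assms
  proof (induction rule: pols_induct)
    case zero
    show ?case by (intro exI[of _ 0]) simp
  next
    case (add f g)
    then obtain p r where
      "degree p \<le> d \<and> (\<forall>s. f (\<lambda>i. a i + s * w i) = poly p s) \<and> (m = d \<longrightarrow> coeff p d = f w)"
      "degree r \<le> d \<and> (\<forall>s. g (\<lambda>i. a i + s * w i) = poly r s) \<and> (m = d \<longrightarrow> coeff r d = g w)"
      by auto
    then show ?case
      by (intro exI[of _ "p + r"]) (auto intro: degree_add_le)
  next
    case (scale c \<alpha>)
    define p where "p = (\<Prod>i\<in>UNIV. [:a i, w i:] ^ \<alpha> i)"
    have power: "degree ([:a i, w i:] ^ k) \<le> k \<and> coeff ([:a i, w i:] ^ k) k = w i ^ k" for i k
    proof (induction k)
      case (Suc k)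
      have "degree [:a i, w i:] \<le> 1" by simp
      with Suc show ?case
        using coeff_mult_degree_le[of "[:a i, w i:]" 1 "[:a i, w i:] ^ k" k]
          degree_mult_le[of "[:a i, w i:]" "[:a i, w i:] ^ k"] by auto
    qed simp
    have "degree (\<Prod>i\<in>A. [:a i, w i:] ^ \<alpha> i) \<le> sum \<alpha> A \<and>
        coeff (\<Prod>i\<in>A. [:a i, w i:] ^ \<alpha> i) (sum \<alpha> A) = (\<Prod>i\<in>A. w i ^ \<alpha> i)" if "finite A" for A
      using that
    proof (induction A rule: finite_induct)
      case (insert i A)
      then show ?case
        using power[of i "\<alpha> i"] degree_mult_le[of "[:a i, w i:] ^ \<alpha> i" "\<Prod>i\<in>A. [:a i, w i:] ^ \<alpha> i"]
        by (auto simp: coeff_mult_degree_le)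
    qed simp
    from this[of UNIV] have p: "degree p \<le> sum \<alpha> UNIV" "coeff p (sum \<alpha> UNIV) = monomial \<alpha> w"
      by (auto simp: p_def monomial_def)
    have "poly p s = monomial \<alpha> (\<lambda>i. a i + s * w i)" for s
      by (simp add: p_def monomial_def poly_prod poly_power)
    moreover have "coeff p d = monomial \<alpha> w" if "m = d"
    proof -
      have "sum \<alpha> UNIV = d"
        using scale that by (simp add: exponents_iff)
      then show ?thesis
        using p(2) by simp
    qed
    ultimately show ?case
      using p scale by (intro exI[of _ "smult (emb c) p"]) (auto simp: exponents_iff)
  qed
  then show ?thesis
    using that by blast
qed

end

lemma poly_altdef_le:
  fixes p :: "'b::comm_semiring_1 poly"
  assumes "degree p \<le> n"
  shows "poly p x = (\<Sum>i\<le>n. coeff p i * x ^ i)"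
  unfolding poly_altdef
  by (rule sum.mono_neutral_left) (use assms in \<open>auto simp: coeff_eq_0\<close>)

lemma sum_multiplicities_le_degree:
  fixes R :: "'k::idom poly"
  assumes "finite S" "R \<noteq> 0" "\<And>c. c \<in> S \<Longrightarrow> [:- c, 1:] ^ k c dvd R"
  shows "(\<Sum>c\<in>S. k c) \<le> degree R"
  using assms
proof (induction S arbitrary: R rule: finite_induct)
  case (insert c S)
  obtain R' where R': "R = [:- c, 1:] ^ k c * R'"
    using insert.prems(2)[of c] by (auto elim: dvdE)
  then have "R' \<noteq> 0"
    using insert.prems by auto
  have "[:- b, 1:] ^ k b dvd R'" if "b \<in> S" for b
  proof -
    have "b \<noteq> c"
      using insert.hyps that by auto
    then have "order b ([:- c, 1:] ^ k c) = 0"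
      by (intro order_0I) (simp add: poly_power)
    then have "order b R = order b R'"
      using insert.prems(1) by (simp add: R' order_mult)
    moreover have "k b \<le> order b R"
      using insert.prems that by (meson insertI2 order_divides)
    ultimately show ?thesis
      by (simp add: order_divides)
  qed
  then have "(\<Sum>c\<in>S. k c) \<le> degree R'"
    using \<open>R' \<noteq> 0\<close> by (intro insert.IH)
  moreover have "degree R = k c + degree R'"
    using \<open>R' \<noteq> 0\<close> by (simp add: R' degree_mult_eq degree_power_eq)
  ultimately show ?case
    using insert.hyps by simp
qed simp

lemma monomial_fun_upd:
  "monomial (\<alpha>(i := k)) x = x i ^ k * monomial (\<alpha>(i := 0)) x"
proof -
  have "(\<Prod>j\<in>UNIV - {i}. x j ^ (\<alpha>(i := k)) j) = (\<Prod>j\<in>UNIV - {i}. x j ^ (\<alpha>(i := 0)) j)"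
    by (intro prod.cong) auto
  then show ?thesis
    unfolding monomial_def by (simp add: prod.remove[of UNIV i])
qed

lemma monomial_at_fun_upd:
  "monomial \<alpha> (x(i := t)) = t ^ \<alpha> i * monomial (\<alpha>(i := 0)) x"
proof -
  have "(\<Prod>j\<in>UNIV - {i}. (x(i := t)) j ^ \<alpha> j) = (\<Prod>j\<in>UNIV - {i}. x j ^ (\<alpha>(i := 0)) j)"
    by (intro prod.cong) auto
  then show ?thesis
    unfolding monomial_def by (simp add: prod.remove[of UNIV i])
qed

lemma sum_fun_upd_exponent: "sum (\<alpha>(i := k)) UNIV + \<alpha> i = sum \<alpha> UNIV + k"
  for \<alpha> :: "'n::finite \<Rightarrow> nat"
proof -
  have "sum (\<alpha>(i := k)) (UNIV - {i}) = sum \<alpha> (UNIV - {i})"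
    by (intro sum.cong) auto
  then show ?thesis
    by (simp add: sum.remove[of UNIV i])
qed

context finite_subfield
begin

lemma vanishes_on_line:
  assumes "vanishes m f u"
  obtains p where "\<And>t. f (\<lambda>i. embv u i + t * v i) = t ^ m * poly p t"
proof -
  obtain d where "(\<lambda>y. f (embv u + y)) \<in> pols (exponents m d)"
    using assms by (auto simp: vanishes_def)
  then have "\<exists>p. \<forall>t. f (embv u + (\<lambda>i. t * v i)) = t ^ m * poly p t"
  proof (induction rule: pols_induct)
    case zero
    show ?case by (intro exI[of _ 0]) simp
  next
    case (add f g)
    then obtain p r where "\<forall>t. f (\<lambda>i. t * v i) = t ^ m * poly p t" "\<forall>t. g (\<lambda>i. t * v i) = t ^ m * poly r t"
      by auto
    then show ?case
      by (intro exI[of _ "p + r"]) (simp add: distrib_left)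
  next
    case (scale c \<alpha>)
    then have "t ^ sum \<alpha> UNIV = t ^ m * t ^ (sum \<alpha> UNIV - m)" for t :: 'k
      by (simp add: exponents_iff flip: power_add)
    then show ?case
      by (intro exI[of _ "monom (emb c * monomial \<alpha> v) (sum \<alpha> UNIV - m)"])
        (simp add: monomial_scale poly_monom mult_ac)
  qed
  then show ?thesis
    using that by (auto simp: plus_fun_def)
qed

text \<open>On the plane through the line spanned by \<open>u\<close> and an arbitrary direction \<open>v\<close>, the
  coefficient of \<open>t ^ i\<close> has degree at most \<open>d - i\<close> but at least
  \<open>\<Sum>c. m c - i\<close> roots, so it is zero.\<close>

lemma vanishes_at_direction:
  fixes a u :: "'a ^ 'n::finite"
  assumes d: "d > 0" and g: "g \<in> pols (exponents d d)" and h: "h \<in> pols (exponents 0 (d - 1))"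
    and vanish: "\<And>c. vanishes (m c) (\<lambda>x. g x + h x) (a + c *s u)"
    and many: "\<And>i. i < l \<Longrightarrow> d < i + (\<Sum>c\<in>UNIV. m c - i)"
  shows "vanishes l g u"
proof (rule vanishes_if_on_lines)
  show "g \<in> pols (exponents 0 d)"
    using g by (rule pols_exponents_mono) auto
  fix v :: "'n \<Rightarrow> 'k"
  define f where "f x = g x + h x" for x
  have "f \<in> pols (exponents 0 d)"
    unfolding f_def using g h by (intro pols_add) (auto elim: pols_exponents_mono)
  then obtain Q where Q: "total_degree_le d Q"
    "\<And>s t. f (\<lambda>i. embv a i + s * embv u i + t * v i) = poly (poly Q [:t:]) s"
    using pols_bivariate[of f d "embv a" "embv u" v] by metis
  \<comment> \<open>One \<open>Q\<close> describes the whole plane. The local expansion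
    \<open>P\<close> at each point of the line has the same values, hence equals \<open>Q\<close>,
    and so the orders at all q points constrain \<open>Q\<close> together.\<close>
  have weight: "vanishing_weight_ge (emb c) (m c) Q" for c
  proof -
    obtain D where "(\<lambda>y. f (embv (a + c *s u) + y)) \<in> pols (exponents (m c) D)"
      using vanish[of c] by (auto simp: vanishes_def f_def)
    from pols_bivariate_vanishing[OF this, of "emb c" "embv u" v] obtain P where P: "vanishing_weight_ge (emb c) (m c) P"
      "\<And>s t. f (embv (a + c *s u) + (\<lambda>i. (s - emb c) * embv u i + t * v i)) = poly (poly P [:t:]) s"
      by metis
    have "embv (a + c *s u) + (\<lambda>i. (s - emb c) * embv u i + t * v i)
        = (\<lambda>i. embv a i + s * embv u i + t * v i)" for s t
      by (auto simp: embv_def fun_eq_iff emb_add emb_mult algebra_simps)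
    then have "P = Q"
      using P(2) Q(2) by (intro bivariate_unique) metis
    then show ?thesis
      using P(1) by simp
  qed
  have zero: "coeff Q i = 0" if "i < l" for i
  proof (rule ccontr)
    assume nz: "coeff Q i \<noteq> 0"
    have "(\<Sum>c\<in>range emb. m (inv emb c) - i) \<le> degree (coeff Q i)"
    proof (rule sum_multiplicities_le_degree[OF _ nz])
      fix c assume "c \<in> range emb"
      then show "[:- c, 1:] ^ (m (inv emb c) - i) dvd coeff Q i"
        using weight[of "inv emb c"] by (auto simp: vanishing_weight_ge_def f_inv_into_f)
    qed simp
    also have "(\<Sum>c\<in>range emb. m (inv emb c) - i) = (\<Sum>c\<in>UNIV. m c - i)"
      by (subst sum.reindex) (auto simp: inj_def inv_f_f)
    also have "i + degree (coeff Q i) \<le> d"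
      using Q(1) nz by (simp add: total_degree_le_def leading_coeff_neq_0)
    ultimately show False
      using many[OF that] by linarith
  qed
  have degQ: "degree Q \<le> d"
  proof (rule degree_le, intro allI impI)
    fix i assume "d < i"
    then have "coeff (coeff Q i) j = 0" for j
      using Q(1) unfolding total_degree_le_def by (meson add_leD1 not_le)
    then show "coeff Q i = 0"
      by (simp add: poly_eq_iff)
  qed
  define \<gamma> where "\<gamma> i = coeff (coeff Q i) (d - i)" for i
  \<comment> \<open>Replacing t by s t turns the plane point into a + s (u + t v). As a polynomial
    in s, the value there has s^d-coefficient g (u + t v), since h has smaller degree; computed from
    \<open>Q\<close>, the same coefficient is the sum of the t^i \<open>\<gamma> i\<close>. The zero
    coefficients of \<open>Q\<close> below l thus pass to g.\<close>
  have top: "g (\<lambda>i. embv u i + t * v i) = (\<Sum>i\<le>d. t ^ i * \<gamma> i)" for t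
  proof -
    define w where "w = (\<lambda>i. embv u i + t * v i)"
    obtain p where p: "\<And>s. g (\<lambda>i. embv a i + s * w i) = poly p s" "coeff p d = g w"
      using pols_univariate[OF g, of "embv a" w] by metis
    obtain r where r: "degree r \<le> d - 1" "\<And>s. h (\<lambda>i. embv a i + s * w i) = poly r s"
      using pols_univariate[OF h, of "embv a" w] by metis
    define Z where "Z = (\<Sum>i\<le>d. smult (t ^ i) (monom 1 i * coeff Q i))"
    have "p + r = Z"
    proof (rule poly_eq_on_infinite[OF infinite_big_field])
      fix s
      have "poly (p + r) s = f (\<lambda>i. embv a i + s * embv u i + (s * t) * v i)"
        by (simp add: p(1)[symmetric] r(2)[symmetric] f_def w_def algebra_simps)
      also have "\<dots> = poly Z s"
        unfolding Q(2) poly_altdef_le[OF degQ] Z_def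
        by (simp add: poly_sum poly_monom poly_power power_mult_distrib mult_ac)
      finally show "poly (p + r) s = poly Z s" .
    qed
    moreover have "coeff r d = 0"
      using r(1) d by (intro coeff_eq_0) linarith
    ultimately have "g w = coeff Z d"
      using p(2) by (metis add.right_neutral coeff_add)
    also have "\<dots> = (\<Sum>i\<le>d. t ^ i * \<gamma> i)"
      unfolding Z_def coeff_sum \<gamma>_def by (intro sum.cong) (auto simp: coeff_monom_mult)
    finally show ?thesis
      by (simp add: w_def)
  qed
  define p where "p = (\<Sum>i\<in>{l..d}. monom (\<gamma> i) (i - l))"
  have "(\<Sum>i\<le>d. t ^ i * \<gamma> i) = (\<Sum>i\<in>{l..d}. t ^ i * \<gamma> i)" for t
    by (intro sum.mono_neutral_right) (auto simp: \<gamma>_def zero not_le)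
  also have "(\<Sum>i\<in>{l..d}. t ^ i * \<gamma> i) = t ^ l * poly p t" for t
    unfolding p_def poly_sum sum_distrib_left
    by (intro sum.cong) (auto simp: poly_monom mult_ac simp flip: power_add mult.assoc)
  finally show "\<exists>p. \<forall>t. g (\<lambda>i. embv u i + t * v i) = t ^ l * poly p t"
    unfolding top by metis
qed

section \<open>Division by x^q - x in one variable\<close>

lemma prod_roots_monic:
  assumes "finite S"
  shows "(\<lambda>x. (\<Prod>c\<in>S. x i - emb c) - x i ^ card S) \<in> pols ((\<lambda>k j. if j = i then k else 0) ` {..<card S})"
  using assms
proof (induction S rule: finite_induct)
  case (insert c S)
  define U where "U n = (\<lambda>k j. if j = i then k else 0 :: nat) ` {..<n}" for n :: nat
  have power: "(\<lambda>x. x i ^ k) \<in> pols (U n)" if "k < n" for k n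
    using pols_monomial[of "U n" "\<lambda>j. if j = i then k else 0"] that
    by (simp add: monomial_unit [abs_def] U_def)
  have "(\<lambda>x. x i - emb c * 1) \<in> pols (U 2)"
    using power[of 0 2] power[of 1 2] by (intro pols_diff pols_scale) auto
  then have "(\<lambda>x. (x i - emb c * 1) * ((\<Prod>c\<in>S. x i - emb c) - x i ^ card S)) \<in> pols (U (Suc (card S)))"
  proof (rule pols_mult)
    show "(\<lambda>x. (\<Prod>c\<in>S. x i - emb c) - x i ^ card S) \<in> pols (U (card S))"
      using insert.IH by (simp add: U_def)
    fix \<alpha> \<beta> assume "\<alpha> \<in> U 2" "\<beta> \<in> U (card S)"
    then obtain k l where "\<alpha> = (\<lambda>j. if j = i then k else 0)" "k < 2"
      "\<beta> = (\<lambda>j. if j = i then l else 0)" "l < card S"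
      by (auto simp: U_def)
    then show "\<alpha> + \<beta> \<in> U (Suc (card S))"
      unfolding U_def by (intro image_eqI[of _ _ "k + l"]) (auto simp: fun_eq_iff)
  qed (simp add: U_def)
  from pols_diff[OF this pols_scale[OF power[of "card S" "Suc (card S)"], of c]] show ?case
    using insert.hyps by (simp add: U_def algebra_simps)
qed simp

text \<open>Restricting the variables to \<open>A\<close> lets an induction on the number of
  variables run inside the fixed index type.\<close>

definition exponents_on :: "'n::finite set \<Rightarrow> nat \<Rightarrow> ('n \<Rightarrow> nat) set" where
  "exponents_on A d = {\<alpha>\<in>exponents 0 d. \<forall>i. i \<notin> A \<longrightarrow> \<alpha> i = 0}"

lemma finite_exponents_on [simp]: "finite (exponents_on A d)"
  by (simp add: exponents_on_def)

lemma exponents_on_subset: "exponents_on A d \<subseteq> exponents 0 d"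
  by (auto simp: exponents_on_def)

text \<open>This is x^q - x. It is kept as a product because the arguments use its simple roots and
  its leading term.\<close>

definition field_polynomial :: "'k \<Rightarrow> 'k" where
  "field_polynomial x = (\<Prod>c\<in>UNIV. x - emb c)"

text \<open>The divisor is monic of degree q in x_i, so the quotient loses q in total degree. The
  case \<open>d < CARD('a)\<close> has its own clause because truncated subtraction then gives
  degree bound 0, which still admits nonzero constants.\<close>

lemma division_by_field_polynomial:
  assumes "f \<in> pols (exponents_on A d)" "i \<in> A"
  obtains g r where "g \<in> pols (exponents_on A (d - CARD('a)))" "d < CARD('a) \<Longrightarrow> g = (\<lambda>x. 0)"
    "r \<in> pols {\<alpha>\<in>exponents_on A d. \<alpha> i < CARD('a)}"
    "\<And>x. f x = field_polynomial (x i) * g x + r x"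
proof -
  define G where "G = {g \<in> pols (exponents_on A (d - CARD('a))). d < CARD('a) \<longrightarrow> g = (\<lambda>x. 0)}"
  define R where "R = pols {\<alpha>\<in>exponents_on A d. \<alpha> i < CARD('a)}"
  define dec where "dec f \<longleftrightarrow> (\<exists>g\<in>G. \<exists>r\<in>R. \<forall>x. f x = field_polynomial (x i) * g x + r x)" for f
  have G_zero: "(\<lambda>x. 0) \<in> G"
    by (simp add: G_def)
  have dec_zero: "dec (\<lambda>x. 0)"
    unfolding dec_def by (rule bexI[OF _ G_zero], rule bexI[of _ "\<lambda>x. 0"]) (auto simp: R_def)
  have dec_add: "dec (\<lambda>x. f x + f' x)" if ff': "dec f" "dec f'" for f f'
  proof -
    obtain g r g' r' where "g \<in> G" "r \<in> R" "g' \<in> G" "r' \<in> R"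
      "\<forall>x. f x = field_polynomial (x i) * g x + r x" "\<forall>x. f' x = field_polynomial (x i) * g' x + r' x"
      using ff' unfolding dec_def by blast
    moreover from this have "(\<lambda>x. g x + g' x) \<in> G" "(\<lambda>x. r x + r' x) \<in> R"
      by (auto simp: G_def R_def intro: pols_add)
    ultimately show ?thesis
      unfolding dec_def by (intro bexI[of _ "\<lambda>x. g x + g' x"] bexI[of _ "\<lambda>x. r x + r' x"])
        (auto simp: algebra_simps)
  qed
  have dec_scale: "dec (\<lambda>x. emb c * f x)" if f: "dec f" for c f
  proof -
    obtain g r where "g \<in> G" "r \<in> R" "\<forall>x. f x = field_polynomial (x i) * g x + r x"
      using f by (auto simp: dec_def)
    moreover from this have "(\<lambda>x. emb c * g x) \<in> G" "(\<lambda>x. emb c * r x) \<in> R"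
      by (auto simp: G_def R_def intro: pols_scale)
    ultimately show ?thesis
      unfolding dec_def by (intro bexI[of _ "\<lambda>x. emb c * g x"] bexI[of _ "\<lambda>x. emb c * r x"])
        (auto simp: algebra_simps)
  qed
  \<comment> \<open>Induction on the exponent of x_i: x_i^q is the field polynomial minus lower
    powers of x_i, and replacing it does not raise the total degree.\<close>
  have dec_monomial: "dec (monomial \<alpha>)" if "\<alpha> \<in> exponents_on A d" for \<alpha>
    using that
  proof (induction "\<alpha> i" arbitrary: \<alpha> rule: less_induct)
    case less
    show ?case
    proof (cases "\<alpha> i < CARD('a)")
      case True
      then have "monomial \<alpha> \<in> R"
        using less.prems unfolding R_def by (intro pols_monomial) auto
      then show ?thesis
        unfolding dec_def by (intro bexI[OF _ G_zero] bexI[of _ "monomial \<alpha>"]) auto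
    next
      case False
      define \<beta> where "\<beta> = \<alpha>(i := \<alpha> i - CARD('a))"
      have sum_\<beta>: "sum \<beta> UNIV + CARD('a) = sum \<alpha> UNIV"
        using sum_fun_upd_exponent[of \<alpha> i "\<alpha> i - CARD('a)"] False by (simp add: \<beta>_def)
      have mono_\<alpha>: "monomial \<alpha> x = x i ^ CARD('a) * monomial \<beta> x" for x :: "'b \<Rightarrow> 'k"
      proof -
        have "monomial \<alpha> x = x i ^ \<alpha> i * monomial (\<alpha>(i := 0)) x"
          using monomial_fun_upd[of \<alpha> i "\<alpha> i" x] by simp
        also have "x i ^ \<alpha> i = x i ^ CARD('a) * x i ^ (\<alpha> i - CARD('a))"
          using False by (simp flip: power_add)
        finally show ?thesis
          unfolding \<beta>_def monomial_fun_upd[of \<alpha> i "\<alpha> i - CARD('a)"] by (simp add: mult_ac del: fun_upd_apply)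
      qed
      have \<beta>: "\<beta> \<in> exponents_on A (d - CARD('a))" "CARD('a) \<le> d"
        using less.prems sum_\<beta> \<open>i \<in> A\<close> by (auto simp: exponents_on_def exponents_iff \<beta>_def)
      then have "monomial \<beta> \<in> G"
        by (auto simp: G_def intro: pols_monomial)
      then have dec1: "dec (\<lambda>x. field_polynomial (x i) * monomial \<beta> x)"
        unfolding dec_def by (rule bexI[rotated], intro bexI[of _ "\<lambda>x. 0"]) (auto simp: R_def)
      have "(\<lambda>x. (field_polynomial (x i) - x i ^ CARD('a)) * monomial \<beta> x)
          \<in> pols {\<gamma>\<in>exponents_on A d. \<gamma> i < \<alpha> i}"
        unfolding field_polynomial_def
      proof (rule pols_mult[OF prod_roots_monic[of UNIV i]])
        show "monomial \<beta> \<in> pols {\<beta>}"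
          by (intro pols_monomial) auto
        fix \<gamma> \<delta> assume "\<gamma> \<in> (\<lambda>k j. if j = i then k else 0) ` {..<CARD('a)}" "\<delta> \<in> {\<beta>}"
        then obtain k where k: "k < CARD('a)" "\<gamma> = (\<lambda>j. if j = i then k else 0)" "\<delta> = \<beta>"
          by auto
        have "sum \<gamma> UNIV = k"
          by (simp add: k)
        then have "sum (\<gamma> + \<delta>) UNIV \<le> d"
          using sum_\<beta> less.prems k by (simp add: sum.distrib exponents_on_def exponents_iff)
        moreover have "(\<gamma> + \<delta>) i < \<alpha> i"
          using False k by (simp add: \<beta>_def)
        moreover have "(\<gamma> + \<delta>) j = 0" if "j \<notin> A" for j
          using \<beta>(1) k that \<open>i \<in> A\<close> by (auto simp: exponents_on_def)
        ultimately show "\<gamma> + \<delta> \<in> {\<gamma>\<in>exponents_on A d. \<gamma> i < \<alpha> i}"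
          by (auto simp: exponents_on_def exponents_iff)
      qed auto
      then have "dec (\<lambda>x. (field_polynomial (x i) - x i ^ CARD('a)) * monomial \<beta> x)"
        by (induction rule: pols_induct) (auto intro: dec_zero dec_add dec_scale less.hyps)
      from dec_add[OF dec1 dec_scale[OF this, of "-1"]] show ?thesis
        by (simp add: emb_minus mono_\<alpha> [abs_def] algebra_simps)
    qed
  qed
  from assms(1) have "dec f"
    by (induction rule: pols_induct) (auto intro: dec_zero dec_add dec_scale dec_monomial)
  then show ?thesis
    using that by (auto simp: dec_def G_def R_def)
qed

text \<open>With the other coordinates fixed anywhere in \<open>'k\<close>, this is a polynomial in
  x_i of degree below q with the q field elements as roots.\<close>

lemma zero_if_low_degree_in_variable:
  assumes "r \<in> pols {\<alpha>\<in>M. \<alpha> i < CARD('a)}" and "\<And>x c. r (x(i := emb c)) = 0"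
  shows "r = (\<lambda>x. 0)"
proof
  fix x
  have "\<exists>p. degree p < CARD('a) \<and> (\<forall>t. r (x(i := t)) = poly p t)"
    using assms(1)
  proof (induction rule: pols_induct)
    case zero
    show ?case by (intro exI[of _ 0]) simp
  next
    case (add f g)
    then obtain p r where "degree p < CARD('a)" "\<forall>t. f (x(i := t)) = poly p t"
      "degree r < CARD('a)" "\<forall>t. g (x(i := t)) = poly r t"
      by blast
    then show ?case
      by (intro exI[of _ "p + r"]) (auto intro: degree_add_less simp del: fun_upd_apply)
  next
    case (scale c \<alpha>)
    then show ?case
      by (intro exI[of _ "monom (emb c * monomial (\<alpha>(i := 0)) x) (\<alpha> i)"])
        (auto simp: monomial_at_fun_upd poly_monom mult_ac simp del: fun_upd_apply
          intro: le_less_trans[OF degree_monom_le])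
  qed
  then obtain p where p: "degree p < CARD('a)" "\<And>t. r (x(i := t)) = poly p t"
    by auto
  have root: "poly p (emb c) = 0" for c
    using p(2)[of "emb c"] assms(2)[of x c] by (simp del: fun_upd_apply)
  have "p = 0"
  proof (rule ccontr)
    assume "p \<noteq> 0"
    have "CARD('a) = card (range emb)"
      by (simp add: card_image inj_def)
    also have "\<dots> \<le> card {t. poly p t = 0}"
      using root by (intro card_mono poly_roots_finite \<open>p \<noteq> 0\<close>) auto
    also have "\<dots> \<le> degree p"
      using \<open>p \<noteq> 0\<close> by (rule card_poly_roots_bound)
    finally show False
      using p(1) by simp
  qed
  then show "r x = 0"
    using p(2)[of "x i"] by simp
qed

end

section \<open>Uniform multiplicities on the affine space\<close>

context finite_subfield
begin

lemma field_polynomial_emb [simp]: "field_polynomial (emb c) = 0"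
  by (auto simp: field_polynomial_def intro!: prod_zero)

text \<open>Every root of \<open>field_polynomial\<close> is simple, so the factor accounts for just
  one order of vanishing.\<close>

lemma vanishes_cofactor:
  assumes g: "g \<in> pols (exponents 0 d)"
    and vanish: "vanishes (Suc l) (\<lambda>x. field_polynomial (x i) * g x) u"
  shows "vanishes l g u"
proof (rule vanishes_if_on_lines[OF g])
  fix v :: "'b \<Rightarrow> 'k" assume v: "\<And>i. v i \<noteq> 0"
  obtain p where p: "\<And>t. field_polynomial (embv u i + t * v i) * g (\<lambda>i. embv u i + t * v i) = t ^ Suc l * poly p t"
    using vanishes_on_line[OF vanish, of v] by metis
  obtain r where r: "\<And>t. g (\<lambda>i. embv u i + t * v i) = poly r t"
    using pols_univariate[OF g, of "embv u" v] by metis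
  \<comment> \<open>The field polynomial along the line, divided by t. Its value at 0 is
    \<open>v i\<close> times a product of differences of distinct field elements, hence
    nonzero.\<close>
  define e where "e = smult (v i) (\<Prod>c\<in>UNIV - {u $ i}. [:emb (u $ i) - emb c, v i:])"
  have field: "field_polynomial (embv u i + t * v i) = poly ([:0, 1:] * e) t" for t
    unfolding field_polynomial_def e_def
    by (simp add: prod.remove[of UNIV "u $ i"] poly_prod embv_def algebra_simps)
  have "[:0, 1:] * (e * r) = [:0, 1:] * ([:0, 1:] ^ l * p)"
  proof (rule poly_eq_on_infinite[OF infinite_big_field])
    fix t
    show "poly ([:0, 1:] * (e * r)) t = poly ([:0, 1:] * ([:0, 1:] ^ l * p)) t"
      using p[of t] unfolding field r by (simp add: poly_power mult_ac)
  qed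
  then have er: "e * r = [:0, 1:] ^ l * p"
    by (metis mult_left_cancel one_neq_zero pCons_eq_0_iff)
  have e0: "poly e 0 \<noteq> 0"
    using v by (simp add: e_def poly_prod flip: emb_diff)
  have "[:0, 1:] ^ l dvd r"
  proof (cases "r = 0")
    case False
    then have nz: "e * r \<noteq> 0"
      using e0 by auto
    have "[:- 0, 1:] ^ l dvd e * r"
      by (simp add: er)
    then have "l \<le> order 0 (e * r)"
      using nz order_divides[of 0 l "e * r"] by simp
    also have "\<dots> = order 0 r"
      using nz e0 by (simp add: order_mult order_0I)
    finally show ?thesis
      using order_divides[of 0 l r] by simp
  qed simp
  then obtain r' where "r = [:0, 1:] ^ l * r'"
    by (elim dvdE)
  then show "\<exists>p. \<forall>t. g (\<lambda>i. embv u i + t * v i) = t ^ l * poly p t"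
    by (auto simp: r poly_power)
qed

lemma pols_restrict_variable:
  assumes "f \<in> pols (exponents_on (insert i A) d)" "i \<notin> A"
  shows "(\<lambda>x. f (x(i := emb c))) \<in> pols (exponents_on A d)"
  using assms(1)
proof (induction rule: pols_induct)
  case (scale b \<alpha>)
  have emb_power: "emb (c ^ k) = emb c ^ k" for k
    by (induction k) (auto simp: emb_mult)
  have "sum (\<alpha>(i := 0)) UNIV \<le> sum \<alpha> UNIV"
    by (intro sum_mono) auto
  then have "\<alpha>(i := 0) \<in> exponents_on A d"
    using scale by (auto simp: exponents_on_def exponents_iff)
  then have "(\<lambda>x. emb (b * c ^ \<alpha> i) * monomial (\<alpha>(i := 0)) x) \<in> pols (exponents_on A d)"
    by (intro pols_scale pols_monomial) auto
  then show ?case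
    by (simp add: monomial_at_fun_upd emb_mult emb_power mult_ac del: fun_upd_apply)
qed (auto intro: pols_add simp del: fun_upd_apply)

lemma vanishes_restrict_variable:
  assumes "\<And>u. vanishes l f u"
  shows "vanishes l (\<lambda>x. f (x(i := emb c))) u"
proof -
  define u' where "u' = (\<chi> j. if j = i then c else u $ j)"
  obtain d where d: "(\<lambda>y. f (embv u' + y)) \<in> pols (exponents l d)"
    using assms[of u'] by (auto simp: vanishes_def)
  have "(\<lambda>y. if j = i then 0 else y j) \<in> pols (exponents 1 1)" for j
    using pols_coordinate[of j] by (cases "j = i") auto
  from pols_substitute[OF d this] have "(\<lambda>y. f (embv u' + (\<lambda>j. if j = i then 0 else y j))) \<in> pols (exponents l d)"
    by simp
  moreover have "embv u' + (\<lambda>j. if j = i then 0 else y j) = (embv u + y)(i := emb c)" for y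
    by (auto simp: embv_def u'_def)
  ultimately show ?thesis
    by (auto simp: vanishes_def)
qed

text \<open>Schwartz-Zippel with multiplicities, by induction on the variables and, inside, on l.
  Fixing x_i in the field gives 0 by the outer hypothesis, so the remainder modulo the field
  polynomial is 0; the quotient has degree smaller by q and order smaller by one, which preserves d
  < q l.\<close>

lemma zero_if_vanishes_everywhere_on:
  fixes f :: "('n::finite \<Rightarrow> 'k) \<Rightarrow> 'k"
  assumes "finite A" "f \<in> pols (exponents_on A d)" "\<And>u. vanishes l f u" "d < CARD('a) * l"
  shows "f = (\<lambda>x. 0)"
  using assms
proof (induction A arbitrary: f d l rule: finite_induct)
  case empty
  have "exponents_on {} d = {0 :: 'n \<Rightarrow> nat}"
    by (auto simp: exponents_on_def exponents_iff)
  moreover obtain b where "f = (\<lambda>x. \<Sum>\<alpha>\<in>exponents_on {} d. emb (b \<alpha>) * monomial \<alpha> x)"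
    using empty.prems(1) by (rule polsE)
  ultimately obtain c where c: "f = (\<lambda>x. emb c)"
    by simp
  have "l > 0"
    using empty.prems(3) by (cases l) auto
  then show ?case
    using vanishes_on_line[OF empty.prems(2)[of 0], of "\<lambda>_. 0"] unfolding c by (metis mult_zero_left zero_power)
next
  case (insert i A)
  show ?case
    using insert.prems
  proof (induction l arbitrary: f d)
    case (Suc l)
    obtain g r where g: "g \<in> pols (exponents_on (insert i A) (d - CARD('a)))"
        "d < CARD('a) \<Longrightarrow> g = (\<lambda>x. 0)"
      and r: "r \<in> pols {\<alpha>\<in>exponents_on (insert i A) d. \<alpha> i < CARD('a)}"
      and f: "\<And>x. f x = field_polynomial (x i) * g x + r x"
      using division_by_field_polynomial[OF Suc.prems(1), of i] by auto
    have "(\<lambda>x. f (x(i := emb c))) = (\<lambda>x. 0)" for c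
      using Suc.prems by (intro insert.IH[of _ d "Suc l"] pols_restrict_variable vanishes_restrict_variable insert.hyps)
    then have "r (x(i := emb c)) = 0" for x c
      using f[of "x(i := emb c)"] by (simp add: fun_eq_iff)
    then have "r = (\<lambda>x. 0)"
      using r by (intro zero_if_low_degree_in_variable)
    then have f_eq: "f = (\<lambda>x. field_polynomial (x i) * g x)"
      using f by auto
    show ?case
    proof (cases "d < CARD('a)")
      case False
      have "g = (\<lambda>x. 0)"
      proof (rule Suc.IH)
        have "g \<in> pols (exponents 0 (d - CARD('a)))"
          using g(1) exponents_on_subset by (rule pols_mono) simp
        then show "vanishes l g u" for u
          using Suc.prems(2)[of u] unfolding f_eq by (rule vanishes_cofactor)
      qed (use g Suc.prems False in auto)
      then show ?thesis
        by (simp add: f_eq)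
    qed (use g f_eq in simp)
  qed simp
qed

lemma zero_if_vanishes_everywhere:
  assumes "f \<in> pols (exponents 0 d)" "\<And>u. vanishes l f u" "d < CARD('a) * l"
  shows "f = (\<lambda>x. 0)"
  using assms zero_if_vanishes_everywhere_on[of UNIV f d l] by (simp add: exponents_on_def)

lemma vanishes_homogeneous_zero:
  assumes "f \<in> pols (exponents d d)"
  shows "vanishes d f 0"
  using assms by (auto simp: vanishes_def embv_def plus_fun_def)

lemma vanishes_mono: "vanishes m f u \<Longrightarrow> l \<le> m \<Longrightarrow> vanishes l f u"
  unfolding vanishes_def by (auto elim: pols_exponents_mono)

section \<open>Linear substitutions and transitivity of the general linear group\<close>

definition linear_action :: "'a ^ 'n ^ 'n \<Rightarrow> ('n::finite \<Rightarrow> 'k) \<Rightarrow> 'n \<Rightarrow> 'k" where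
  "linear_action A x = (\<lambda>i. \<Sum>j\<in>UNIV. emb (A $ i $ j) * x j)"

lemma linear_action_embv: "linear_action A (embv u) = embv (A *v u)"
  by (simp add: linear_action_def embv_def matrix_vector_mult_def emb_sum emb_mult)

lemma linear_action_add: "linear_action A (x + y) = linear_action A x + linear_action A y"
  by (simp add: linear_action_def fun_eq_iff distrib_left sum.distrib)

lemma linear_action_mult: "linear_action A (linear_action B x) = linear_action (A ** B) x"
proof
  fix i
  have "(\<Sum>j\<in>UNIV. emb (A $ i $ j) * (\<Sum>k\<in>UNIV. emb (B $ j $ k) * x k))
      = (\<Sum>j\<in>UNIV. \<Sum>k\<in>UNIV. emb (A $ i $ j) * emb (B $ j $ k) * x k)"
    by (simp add: sum_distrib_left mult.assoc)
  also have "\<dots> = (\<Sum>k\<in>UNIV. \<Sum>j\<in>UNIV. emb (A $ i $ j) * emb (B $ j $ k) * x k)"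
    by (rule sum.swap)
  finally show "linear_action A (linear_action B x) i = linear_action (A ** B) x i"
    by (simp add: linear_action_def matrix_matrix_mult_def emb_sum emb_mult sum_distrib_right)
qed

lemma linear_action_one: "linear_action (mat 1) x = x"
proof
  fix i
  have "(\<Sum>j\<in>UNIV. emb (mat 1 $ i $ j) * x j) = (\<Sum>j\<in>UNIV. if i = j then x j else 0)"
    by (intro sum.cong) (auto simp: mat_def)
  then show "linear_action (mat 1) x i = x i"
    by (simp add: linear_action_def)
qed

lemma linear_action_coordinate: "(\<lambda>x. linear_action A x i) \<in> pols (exponents 1 1)"
  unfolding linear_action_def by (intro pols_sum pols_scale pols_coordinate)

lemma pols_linear_action:
  assumes "f \<in> pols (exponents m d)"
  shows "(\<lambda>x. f (linear_action A x)) \<in> pols (exponents m d)"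
  using pols_substitute[OF assms linear_action_coordinate[of A]] by simp

lemma vanishes_linear_action:
  assumes "vanishes m f (A *v u)"
  shows "vanishes m (\<lambda>x. f (linear_action A x)) u"
  using assms pols_linear_action[of "\<lambda>y. f (embv (A *v u) + y)" m _ A]
  unfolding vanishes_def by (auto simp: linear_action_add linear_action_embv)

end

text \<open>For a linear functional l with l(u) = 1, the map x + l(x) (v - u) sends u to v; it is
  invertible once l(v) is nonzero.\<close>

lemma transitive_invertible_matrices:
  fixes u v :: "'a::field ^ 'n::finite"
  assumes "u \<noteq> 0" "v \<noteq> 0"
  obtains A where "invertible A" "A *v u = v"
proof -
  note result = that
  have transvection: thesis if "(\<Sum>j\<in>UNIV. c $ j * u $ j) = 1" "(\<Sum>j\<in>UNIV. c $ j * v $ j) \<noteq> 0" for c :: "'a ^ 'n"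
  proof -
    define l where "l x = (\<Sum>j\<in>UNIV. c $ j * x $ j)" for x :: "'a ^ 'n"
    have l_add: "l (x + y) = l x + l y" and l_scale: "l (k *s x) = k * l x" and l_diff: "l (x - y) = l x - l y" for x y k
      by (simp_all add: l_def sum.distrib sum_subtractf sum_distrib_left algebra_simps)
    have l_uv: "l u = 1" "l v \<noteq> 0"
      using that by (simp_all add: l_def)
    define T where "T k = (\<chi> i j. (if i = j then 1 else 0) + k * (v $ i - u $ i) * c $ j)" for k
    have T: "T k *v x = x + (k * l x) *s (v - u)" for k x
    proof -
      have "(T k *v x) $ i = (\<Sum>j\<in>UNIV. (if i = j then x $ j else 0) + k * (v $ i - u $ i) * (c $ j * x $ j))" for i
        unfolding T_def matrix_vector_mult_def by (auto simp: algebra_simps intro!: sum.cong)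
      then show ?thesis
        by (simp add: vec_eq_iff sum.distrib l_def flip: sum_distrib_left)
    qed
    \<comment> \<open>\<open>T 1\<close> multiplies l by l(v), so undoing its shift takes the factor
      -1 / l(v).\<close>
    define k where "k = - inverse (l v)"
    have "T 1 *v (T k *v x) = x" "T k *v (T 1 *v x) = x" for x
      using l_uv unfolding T vector_add_ldistrib
      by (simp_all add: T l_add l_scale l_diff k_def vec_eq_iff field_simps)
    then have "T 1 ** T k = mat 1" "T k ** T 1 = mat 1"
      by (simp_all add: matrix_eq flip: matrix_vector_mul_assoc)
    then have "invertible (T 1)"
      unfolding invertible_def by blast
    moreover have "T 1 *v u = v"
      by (simp add: T l_uv)
    ultimately show thesis
      by (rule result)
  qed
  obtain i where i: "u $ i \<noteq> 0"
    using assms(1) by (auto simp: vec_eq_iff)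
  obtain j where j: "v $ j \<noteq> 0"
    using assms(2) by (auto simp: vec_eq_iff)
  have axis_sum: "(\<Sum>l\<in>UNIV. (if l = m then b else 0) * x $ l) = b * x $ m" for b m and x :: "'a ^ 'n"
    by (simp add: if_distrib[of "\<lambda>z. z * _"] cong: if_cong)
  show thesis
  proof (cases "\<exists>i. u $ i \<noteq> 0 \<and> v $ i \<noteq> 0")
    case True
    then obtain m where "u $ m \<noteq> 0" "v $ m \<noteq> 0"
      by auto
    then show thesis
      by (intro transvection[of "\<chi> l. if l = m then inverse (u $ m) else 0"]) (simp_all add: axis_sum)
  next
    \<comment> \<open>No coordinate is nonzero in both vectors; the functional x_i / u_i + x_j is 1
      at u and v_j at v.\<close>
    case False
    then have zero: "v $ i = 0" "u $ j = 0"
      using i j by auto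
    have "(\<Sum>l\<in>UNIV. ((if l = i then inverse (u $ i) else 0) + (if l = j then 1 else 0)) * x $ l)
        = inverse (u $ i) * x $ i + x $ j" for x
      using axis_sum[of i "inverse (u $ i)" x] axis_sum[of j 1 x] by (simp add: distrib_right sum.distrib)
    then show thesis
      using i j zero
      by (intro transvection[of "\<chi> l. (if l = i then inverse (u $ i) else 0) + (if l = j then 1 else 0)"])
        simp_all
  qed
qed

section \<open>Conditions at the directions\<close>

text \<open>Composing with an element that sends w to w' embeds the transporters from u to w into
  those from u to w'. So all transporters from u have equal size, and they partition
  \<Gamma>.\<close>

lemma card_transporter:
  fixes \<Gamma> :: "('x \<Rightarrow> 'x) set"
  assumes \<Gamma>: "finite \<Gamma>" "\<And>\<gamma>. \<gamma> \<in> \<Gamma> \<Longrightarrow> bij \<gamma> \<and> \<gamma> ` X \<subseteq> X"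
    and mult: "\<And>\<gamma> \<delta>. \<gamma> \<in> \<Gamma> \<Longrightarrow> \<delta> \<in> \<Gamma> \<Longrightarrow> \<gamma> \<circ> \<delta> \<in> \<Gamma>"
    and transitive: "\<And>u v. u \<in> X \<Longrightarrow> v \<in> X \<Longrightarrow> \<exists>\<gamma>\<in>\<Gamma>. \<gamma> u = v"
    and X: "finite X" "u \<in> X" "v \<in> X"
  shows "card {\<gamma>\<in>\<Gamma>. \<gamma> u = v} * card X = card \<Gamma>"
proof -
  have le: "card {\<gamma>\<in>\<Gamma>. \<gamma> u = w} \<le> card {\<gamma>\<in>\<Gamma>. \<gamma> u = w'}" if w: "w \<in> X" "w' \<in> X" for w w'
  proof -
    obtain \<delta> where \<delta>: "\<delta> \<in> \<Gamma>" "\<delta> w = w'"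
      using transitive[OF w] by auto
    have "inj \<delta>"
      using \<Gamma>(2)[OF \<delta>(1)] by (simp add: bij_def)
    show ?thesis
    proof (rule card_inj_on_le[where f = "\<lambda>\<gamma>. \<delta> \<circ> \<gamma>"])
      show "inj_on (\<lambda>\<gamma>. \<delta> \<circ> \<gamma>) {\<gamma>\<in>\<Gamma>. \<gamma> u = w}"
        using \<open>inj \<delta>\<close> by (auto simp: inj_on_def fun_eq_iff)
    qed (use \<Gamma> \<delta> mult in auto)
  qed
  have "\<Gamma> = (\<Union>w\<in>X. {\<gamma>\<in>\<Gamma>. \<gamma> u = w})"
    using \<Gamma>(2) X by auto
  then have "card \<Gamma> = card (\<Union>w\<in>X. {\<gamma>\<in>\<Gamma>. \<gamma> u = w})"
    by simp
  also have "\<dots> = (\<Sum>w\<in>X. card {\<gamma>\<in>\<Gamma>. \<gamma> u = w})"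
    using \<Gamma>(1) X(1) by (intro card_UN_disjoint) auto
  also have "\<dots> = (\<Sum>w\<in>X. card {\<gamma>\<in>\<Gamma>. \<gamma> u = v})"
    using le X by (intro sum.cong refl antisym) auto
  finally show ?thesis
    by simp
qed

lemma card_exponents_sum: "card (exponents m d :: ('n::finite \<Rightarrow> nat) set) = (\<Sum>e\<in>{m..d}. card (exponents e e :: ('n \<Rightarrow> nat) set))"
proof -
  have "(exponents m d :: ('n \<Rightarrow> nat) set) = (\<Union>e\<in>{m..d}. exponents e e)"
    by (auto simp: exponents_iff)
  then show ?thesis
    by (simp only:) (intro card_UN_disjoint; auto simp: exponents_iff)
qed

lemma exponents_0_0: "exponents 0 0 = {0}"
  by (auto simp: exponents_iff fun_eq_iff)

context finite_subfield
begin

lemma card_field_ge_2: "CARD('a) \<ge> 2"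
  using card_mono[of "UNIV :: 'a set" "{0, 1}"] by simp

text \<open>The points are nonzero vectors instead of directions, so that matrices act on them
  directly; the resulting factor q - 1 cancels in the final theorem.\<close>

lemma ln_card_vanishing_homogeneous_le:
  fixes U :: "('a ^ 'n::finite) set"
  assumes d: "d > 0" and U: "U \<subseteq> - {0}"
  defines "X \<equiv> - {0} :: ('a ^ 'n) set"
  shows "card X * ln (card {f \<in> pols (exponents d d). \<forall>u\<in>U. vanishes (Suc (d div CARD('a))) f u}) \<le>
    (real (card X) - card U) * (card (exponents d d :: ('n \<Rightarrow> nat) set) * ln (CARD('a)))"
proof -
  define l where "l = Suc (d div CARD('a))"
  define \<Gamma> where "\<Gamma> = (*v) ` {A :: 'a ^ 'n ^ 'n. invertible A}"
  have \<Gamma>: "bij \<gamma> \<and> \<gamma> ` X \<subseteq> X" if "\<gamma> \<in> \<Gamma>" for \<gamma>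
  proof -
    obtain A B where A: "\<gamma> = (*v) A" "A ** B = mat 1" "B ** A = mat 1"
      using \<open>\<gamma> \<in> \<Gamma>\<close> by (auto simp: \<Gamma>_def invertible_def)
    then have inv: "B *v (A *v x) = x" "A *v (B *v x) = x" for x
      by (simp_all add: matrix_vector_mul_assoc)
    have "bij \<gamma>"
      unfolding A(1) by (rule o_bij[of "(*v) B"]) (auto simp: inv)
    moreover have "\<gamma> ` X \<subseteq> X"
    proof (rule image_subsetI)
      fix x assume "x \<in> X"
      then have "A *v x \<noteq> 0"
        using inv(1)[of x] by (metis X_def ComplD insertI1 matrix_vector_mult_0_right)
      then show "\<gamma> x \<in> X"
        by (simp add: A(1) X_def)
    qed
    ultimately show ?thesis ..
  qed
  have "card X * ln (card {f \<in> pols (exponents d d). \<forall>u\<in>U. f \<in> {f. vanishes l f u}}) \<le>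
    (real (card X) - card U) * ln (card (pols (exponents d d) :: (('n \<Rightarrow> 'k) \<Rightarrow> 'k) set))"
  proof (rule ln_card_conditions_le[where \<Gamma> = \<Gamma>])
    show "additive_subgroup (pols (exponents d d) :: (('n \<Rightarrow> 'k) \<Rightarrow> 'k) set)"
      using pols_zero pols_diff unfolding additive_subgroup_def fun_diff_def zero_fun_def by auto
    show "finite (pols (exponents d d) :: (('n \<Rightarrow> 'k) \<Rightarrow> 'k) set)"
      by (simp add: card_pols)
    show "additive_subgroup {f. vanishes l f u}" for u :: "'a ^ 'n"
      by (rule vanishes_subgroup)
    show "\<Gamma> \<noteq> {}"
    proof -
      have "invertible (mat 1 :: 'a ^ 'n ^ 'n)"
        unfolding invertible_def by (rule exI[of _ "mat 1"]) simp
      then show ?thesis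
        by (auto simp: \<Gamma>_def)
    qed
    show "inj_on \<gamma> X \<and> \<gamma> ` X \<subseteq> X" if "\<gamma> \<in> \<Gamma>" for \<gamma>
      using \<Gamma>[OF that] by (auto simp: bij_def intro: inj_on_subset)
    show "card {\<gamma>\<in>\<Gamma>. \<gamma> u = v} * card X = card \<Gamma>" if "u \<in> X" "v \<in> X" for u v
    proof (rule card_transporter)
      show "\<gamma> \<circ> \<delta> \<in> \<Gamma>" if \<gamma>\<delta>: "\<gamma> \<in> \<Gamma>" "\<delta> \<in> \<Gamma>" for \<gamma> \<delta>
      proof -
        obtain A B where AB: "\<gamma> = (*v) A" "\<delta> = (*v) B" "invertible A" "invertible B"
          using \<gamma>\<delta> by (auto simp: \<Gamma>_def)
        then have "\<gamma> \<circ> \<delta> = (*v) (A ** B)"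
          by (auto simp: matrix_vector_mul_assoc)
        then show ?thesis
          using AB by (auto simp: \<Gamma>_def invertible_mult)
      qed
      show "\<exists>\<gamma>\<in>\<Gamma>. \<gamma> u = v" if "u \<in> X" "v \<in> X" for u v
        using that transitive_invertible_matrices[of u v] by (auto simp: \<Gamma>_def X_def)
    qed (use that \<Gamma> in \<open>auto simp: \<Gamma>_def\<close>)
    show "card {f \<in> pols (exponents d d). \<forall>u\<in>W. f \<in> {f. vanishes l f u}} \<le>
      card {f \<in> pols (exponents d d). \<forall>u\<in>\<gamma> ` W. f \<in> {f. vanishes l f u}}" if \<gamma>: "\<gamma> \<in> \<Gamma>" for \<gamma> W
    proof -
      obtain A B where A: "\<gamma> = (*v) A" "A ** B = mat 1" "B ** A = mat 1"
        using \<gamma> by (auto simp: \<Gamma>_def invertible_def)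
      show ?thesis
      \<comment> \<open>Composing with the inverse matrix moves a zero at u to \<open>A *v u\<close>
        with the same order.\<close>
      proof (rule card_inj_on_le[where f = "\<lambda>f x. f (linear_action B x)"])
        show "inj_on (\<lambda>f x. f (linear_action B x)) {f \<in> pols (exponents d d). \<forall>u\<in>W. f \<in> {f. vanishes l f u}}"
        proof (rule inj_onI, rule ext)
          fix f g and x :: "'n \<Rightarrow> 'k"
          assume eq: "(\<lambda>x. f (linear_action B x)) = (\<lambda>x. g (linear_action B x))"
          show "f x = g x"
            using fun_cong[OF eq, of "linear_action A x"] by (simp add: linear_action_mult A linear_action_one)
        qed
        show "(\<lambda>f x. f (linear_action B x)) ` {f \<in> pols (exponents d d). \<forall>u\<in>W. f \<in> {f. vanishes l f u}} \<subseteq>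
          {f \<in> pols (exponents d d). \<forall>u\<in>\<gamma> ` W. f \<in> {f. vanishes l f u}}"
          by (auto simp: A matrix_vector_mul_assoc intro!: pols_linear_action vanishes_linear_action)
      qed (simp add: card_pols)
    qed
    show "card {f \<in> pols (exponents d d). \<forall>u\<in>X. f \<in> {f. vanishes l f u}} = 1"
    proof -
      have "f = (\<lambda>x. 0)" if f: "f \<in> pols (exponents d d)" "\<forall>u\<in>X. vanishes l f u" for f
      proof (rule zero_if_vanishes_everywhere)
        show "f \<in> pols (exponents 0 d)"
          using f(1) by (rule pols_exponents_mono) auto
        \<comment> \<open>The origin is not in \<open>X\<close>, but a form of degree d has order d
          there, and d \<ge> l because q \<ge> 2 and d > 0.\<close>
        have "d div CARD('a) < d"
          using d card_field_ge_2 by (intro div_less_dividend) auto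
        then have "l \<le> d"
          by (simp add: l_def)
        then have "vanishes l f 0"
          using vanishes_homogeneous_zero[OF f(1)] by (rule vanishes_mono[rotated])
        then show "vanishes l f u" for u
          using f(2) by (cases "u = 0") (auto simp: X_def)
        show "d < CARD('a) * l"
          unfolding l_def using dividend_less_times_div[of "CARD('a)" d] by simp
      qed
      then have "{f \<in> pols (exponents d d). \<forall>u\<in>X. f \<in> {f. vanishes l f u}} = {\<lambda>x. 0}"
        by (auto simp: vanishes_zero)
      then show ?thesis
        by simp
    qed
  qed (use U in \<open>auto simp: X_def \<Gamma>_def\<close>)
  moreover have "ln (card (pols (exponents d d) :: (('n \<Rightarrow> 'k) \<Rightarrow> 'k) set)) =
      card (exponents d d :: ('n \<Rightarrow> nat) set) * ln (CARD('a))"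
    by (simp add: card_pols ln_realpow)
  ultimately show ?thesis
    by (simp add: l_def)
qed

section \<open>The degree filtration of \<open>K\<close>\<close>

lemma pols_split_top:
  assumes "f \<in> pols (exponents 0 d)"
  obtains g h where "g \<in> pols (exponents d d)" "h \<in> pols (exponents 0 (d - 1))" "f = (\<lambda>x. g x + h x)"
proof -
  have "\<exists>g\<in>pols (exponents d d). \<exists>h\<in>pols (exponents 0 (d - 1)). f = (\<lambda>x. g x + h x)"
    using assms
  proof (induction rule: pols_induct)
    case zero
    show ?case by (intro bexI[of _ "\<lambda>x. 0"]) auto
  next
    case (add f f')
    then obtain g h g' h' where "g \<in> pols (exponents d d)" "h \<in> pols (exponents 0 (d - 1))" "f = (\<lambda>x. g x + h x)"
      "g' \<in> pols (exponents d d)" "h' \<in> pols (exponents 0 (d - 1))" "f' = (\<lambda>x. g' x + h' x)"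
      by blast
    then show ?case
      by (intro bexI[of _ "\<lambda>x. g x + g' x"] bexI[of _ "\<lambda>x. h x + h' x"] pols_add) (auto simp: algebra_simps)
  next
    case (scale c \<alpha>)
    show ?case
    proof (cases "sum \<alpha> UNIV = d")
      case True
      then show ?thesis
        by (intro bexI[of _ "\<lambda>x. emb c * monomial \<alpha> x"] bexI[of _ "\<lambda>x. 0"] pols_scale pols_monomial)
          (auto simp: exponents_iff)
    next
      case False
      then show ?thesis
        using scale
        by (intro bexI[of _ "\<lambda>x. emb c * monomial \<alpha> x"] bexI[of _ "\<lambda>x. 0"] pols_scale pols_monomial)
          (auto simp: exponents_iff)
    qed
  qed
  then show ?thesis
    using that by auto
qed

text \<open>Up to degree \<open>D u\<close> the line chosen for u forces its condition. In degree e
  the top forms of \<open>K\<close> are restricted at the points of \<open>U e\<close>, which leaves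
  at most the fraction 1 - |U e| / |X| of the full logarithmic size. Comparison with the lower bound
  for \<open>K\<close> gives the sum of |U e| times the number of monomials of degree e; sorted by u
  it is the left-hand side.\<close>

lemma sum_card_exponents_le:
  fixes m :: "'a ^ 'n::finite \<Rightarrow> nat" and a :: "'a ^ 'n \<Rightarrow> 'a ^ 'n" and D :: "'a ^ 'n \<Rightarrow> nat"
  defines "X \<equiv> - {0} :: ('a ^ 'n) set"
  assumes many: "\<And>u d i. u \<noteq> 0 \<Longrightarrow> 0 < d \<Longrightarrow> d \<le> D u \<Longrightarrow> i \<le> d div CARD('a) \<Longrightarrow>
    d < i + (\<Sum>c\<in>UNIV. m (a u + c *s u) - i)"
  shows "(\<Sum>u\<in>X. card (exponents 1 (D u) :: ('n \<Rightarrow> nat) set)) \<le>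
    card X * (\<Sum>x\<in>UNIV. card {\<alpha>::'n \<Rightarrow> nat. sum \<alpha> UNIV < m x})"
proof -
  define DM where "DM = Max (insert 0 (D ` X))"
  have DM: "D u \<le> DM" if "u \<in> X" for u
    using that by (simp add: DM_def)
  define P where "P d = (pols (exponents 0 d) :: (('n \<Rightarrow> 'k) \<Rightarrow> 'k) set)" for d
  define H where "H d = card (exponents d d :: ('n \<Rightarrow> nat) set)" for d
  define low where "low x = card {\<alpha>::'n \<Rightarrow> nat. sum \<alpha> UNIV < m x}" for x
  define U where "U d = {u \<in> X. d \<le> D u}" for d
  define K where "K = {f \<in> P DM. \<forall>x\<in>UNIV. f \<in> {f \<in> P DM. vanishes (m x) f x}}"
  define q where "q = CARD('a)"
  have "ln q > 0"
    using card_field_ge_2 by (simp add: q_def)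
  have P: "additive_subgroup (P d)" "finite (P d)" for d
    using pols_zero pols_diff by (auto simp: P_def card_pols additive_subgroup_def fun_diff_def zero_fun_def)
  have card_P: "card (P DM) \<le> q ^ (\<Sum>x\<in>UNIV. low x) * card K"
    unfolding K_def
  proof (rule card_INT_subgroups_le[OF P])
    show "additive_subgroup {f \<in> P DM. vanishes (m x) f x}" for x
      unfolding P_def by (rule vanishes_subgroup)
    show "card (P DM) \<le> q ^ low x * card {f \<in> P DM. vanishes (m x) f x}" for x
      unfolding P_def q_def low_def by (rule card_pols_le_vanishing)
  qed auto
  have K: "additive_subgroup K"
    using P[of DM] vanishes_subgroup(2)[of "m _"] unfolding K_def additive_subgroup_def by auto
  have KP: "additive_subgroup (K \<inter> P d)" "finite (K \<inter> P d)" for d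
    using additive_subgroup_Int[OF K P(1)] P(2) by auto
  have KP_pos: "real (card (K \<inter> P d)) > 0" for d
    using card_additive_subgroup_pos[OF KP] by simp
  have step: "card X * ln (card (K \<inter> P (Suc d))) \<le>
    card X * ln (card (K \<inter> P d)) + (real (card X) - card (U (Suc d))) * (H (Suc d) * ln q)" for d
  proof -
    define T where "T = {g \<in> pols (exponents (Suc d) (Suc d)). \<forall>u\<in>U (Suc d). vanishes (Suc (Suc d div CARD('a))) g u}"
    have "card (K \<inter> P (Suc d)) \<le> card ((K \<inter> P (Suc d)) \<inter> P d) * card T"
    proof (rule card_subgroup_le_card_quotient[OF KP P(1)])
      show "finite T"
        by (simp add: T_def card_pols)
      fix f assume f: "f \<in> K \<inter> P (Suc d)"
      then obtain g h where gh: "g \<in> pols (exponents (Suc d) (Suc d))" "h \<in> pols (exponents 0 d)" "f = (\<lambda>x. g x + h x)"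
        using pols_split_top[of f "Suc d"] by (auto simp: P_def)
      have "vanishes (Suc (Suc d div CARD('a))) g u" if u: "u \<in> U (Suc d)" for u
      proof (rule vanishes_at_direction[OF _ gh(1), where h = h and a = "a u" and m = "\<lambda>c. m (a u + c *s u)"])
        show "vanishes (m (a u + c *s u)) (\<lambda>x. g x + h x) (a u + c *s u)" for c
          using f by (simp add: K_def gh(3))
        show "Suc d < i + (\<Sum>c\<in>UNIV. m (a u + c *s u) - i)" if "i < Suc (Suc d div CARD('a))" for i
          using u that by (intro many) (auto simp: U_def X_def)
      qed (use gh in auto)
      then have "g \<in> T"
        using gh by (simp add: T_def)
      moreover have "f - g \<in> P d"
        using gh by (simp add: P_def fun_diff_def)
      ultimately show "\<exists>g\<in>T. f - g \<in> P d" by blast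
    qed
    also have "(K \<inter> P (Suc d)) \<inter> P d = K \<inter> P d"
      by (auto simp: P_def elim: pols_exponents_mono)
    finally have le: "card (K \<inter> P (Suc d)) \<le> card (K \<inter> P d) * card T" .
    then have T_pos: "real (card T) > 0"
      using KP_pos[of "Suc d"] by (cases "card T = 0") auto
    have "ln (card (K \<inter> P (Suc d))) \<le> ln (real (card (K \<inter> P d)) * card T)"
      using le KP_pos T_pos by (subst ln_le_cancel_iff) (simp_all flip: of_nat_mult)
    also have "\<dots> = ln (card (K \<inter> P d)) + ln (card T)"
      using KP_pos[of d] T_pos by (simp add: ln_mult)
    finally have "card X * ln (card (K \<inter> P (Suc d))) \<le> card X * ln (card (K \<inter> P d)) + card X * ln (card T)"
      by (metis distrib_left mult_left_mono of_nat_0_le_iff)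
    also have "card X * ln (card T) \<le> (real (card X) - card (U (Suc d))) * (H (Suc d) * ln q)"
      unfolding T_def H_def q_def X_def
      by (intro ln_card_vanishing_homogeneous_le) (auto simp: U_def X_def)
    finally show ?thesis
      by simp
  qed
  \<comment> \<open>The constants are bounded by one full dimension, the summand
    \<open>card X\<close>. It cancels the degree-0 monomial on the other side, and so the result
    counts from degree 1.\<close>
  have upper: "card X * ln (card (K \<inter> P d)) \<le>
      ln q * (card X + (\<Sum>e\<in>{1..d}. (real (card X) - card (U e)) * H e))" for d
  proof (induction d)
    case 0
    have "card (K \<inter> P 0) \<le> card (P 0)"
      by (intro card_mono P) auto
    also have "\<dots> = q"
      unfolding P_def by (subst card_pols) (simp_all add: exponents_0_0 q_def)
    finally have "ln (card (K \<inter> P 0)) \<le> ln q"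
      using KP_pos[of 0] by simp
    then have "card X * ln (card (K \<inter> P 0)) \<le> card X * ln q"
      by (intro mult_left_mono) auto
    then show ?case
      by (simp add: mult.commute)
  next
    case (Suc d)
    then show ?case
      using step[of d] by (simp add: algebra_simps)
  qed
  have "K \<inter> P DM = K"
    by (auto simp: K_def)
  have "real q ^ card (exponents 0 DM :: ('n \<Rightarrow> nat) set) \<le> real q ^ (\<Sum>x\<in>UNIV. low x) * card K"
    using card_P unfolding P_def by (simp add: card_pols q_def flip: of_nat_power of_nat_mult)
  then have "ln (real q ^ card (exponents 0 DM :: ('n \<Rightarrow> nat) set)) \<le> ln (real q ^ (\<Sum>x\<in>UNIV. low x) * card K)"
    using KP_pos[of DM] \<open>K \<inter> P DM = K\<close> by (subst ln_le_cancel_iff) (auto simp: q_def)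
  also have "\<dots> = (\<Sum>x\<in>UNIV. low x) * ln q + ln (card K)"
    using KP_pos[of DM] \<open>K \<inter> P DM = K\<close> by (simp add: ln_mult ln_realpow q_def)
  finally have "(\<Sum>e\<in>{0..DM}. H e) * ln q \<le> (\<Sum>x\<in>UNIV. low x) * ln q + ln (card K)"
    unfolding card_exponents_sum[of 0] H_def by (simp add: ln_realpow q_def)
  then have "card X * ((\<Sum>e\<in>{0..DM}. H e) * ln q) \<le> card X * ((\<Sum>x\<in>UNIV. low x) * ln q) + card X * ln (card K)"
    by (metis distrib_left mult_left_mono of_nat_0_le_iff)
  also have "card X * ln (card K) \<le>
      ln q * (card X + (\<Sum>e\<in>{1..DM}. (real (card X) - card (U e)) * H e))"
    using upper[of DM] \<open>K \<inter> P DM = K\<close> by simp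
  finally have "ln q * (card X * (\<Sum>e\<in>{0..DM}. H e)) \<le>
      ln q * (card X * (\<Sum>x\<in>UNIV. low x) + card X + (\<Sum>e\<in>{1..DM}. (real (card X) - card (U e)) * H e))"
    by (simp add: algebra_simps)
  then have "real (card X * (\<Sum>e\<in>{0..DM}. H e)) \<le>
      card X * (\<Sum>x\<in>UNIV. low x) + card X + (\<Sum>e\<in>{1..DM}. (real (card X) - card (U e)) * H e)"
    using \<open>ln q > 0\<close> by (simp only: mult_le_cancel_left_pos)
  moreover have "(\<Sum>e\<in>{0..DM}. H e) = 1 + (\<Sum>e\<in>{1..DM}. H e)"
    by (simp add: sum.atLeast_Suc_atMost H_def exponents_0_0)
  ultimately have "(\<Sum>e\<in>{1..DM}. real (card (U e)) * H e) \<le> card X * (\<Sum>x\<in>UNIV. low x)"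
    by (simp add: algebra_simps sum_subtractf sum_distrib_left)
  moreover have "(\<Sum>u\<in>X. card (exponents 1 (D u) :: ('n \<Rightarrow> nat) set)) = (\<Sum>e\<in>{1..DM}. card (U e) * H e)"
  proof -
    have "(\<Sum>u\<in>X. card (exponents 1 (D u) :: ('n \<Rightarrow> nat) set)) = (\<Sum>u\<in>X. \<Sum>e\<in>{1..DM}. if e \<le> D u then H e else 0)"
    proof (intro sum.cong refl)
      fix u assume "u \<in> X"
      then have "D u \<le> DM" by (rule DM)
      have "(\<Sum>e\<in>{1..D u}. H e) = (\<Sum>e\<in>{1..DM}. if e \<le> D u then H e else 0)"
        using \<open>D u \<le> DM\<close> by (intro sum.mono_neutral_cong_left) auto
      then show "card (exponents 1 (D u) :: ('n \<Rightarrow> nat) set) = (\<Sum>e\<in>{1..DM}. if e \<le> D u then H e else 0)"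
        unfolding card_exponents_sum[of 1] H_def .
    qed
    also have "\<dots> = (\<Sum>e\<in>{1..DM}. \<Sum>u\<in>X. if e \<le> D u then H e else 0)"
      by (rule sum.swap)
    also have "\<dots> = (\<Sum>e\<in>{1..DM}. card (U e) * H e)"
    proof (intro sum.cong refl)
      fix e
      show "(\<Sum>u\<in>X. if e \<le> D u then H e else 0) = card (U e) * H e"
        using sum.inter_filter[of X "\<lambda>_. H e" "\<lambda>u. e \<le> D u"] by (simp add: U_def)
    qed
    finally show ?thesis .
  qed
  ultimately have "real (\<Sum>u\<in>X. card (exponents 1 (D u) :: ('n \<Rightarrow> nat) set)) \<le> real (card X * (\<Sum>x\<in>UNIV. low x))"
    by simp
  then show ?thesis
    by (simp only: of_nat_le_iff low_def)
qed

end

section \<open>Counting monomials\<close>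

text \<open>Stars and bars, after reading exponent vectors as lists along an enumeration of
  \<open>'n\<close>.\<close>

lemma card_exponents_eq: "card (exponents e e :: ('n::finite \<Rightarrow> nat) set) = (e + CARD('n) - 1) choose e"
proof -
  obtain xs :: "'n list" where xs: "distinct xs" "set xs = UNIV"
    using finite_distinct_list[of "UNIV :: 'n set"] by auto
  have length: "length xs = CARD('n)"
    using distinct_card[OF xs(1)] xs(2) by simp
  have bij: "bij_betw (\<lambda>\<alpha>. map \<alpha> xs) (exponents e e) {l::nat list. length l = CARD('n) \<and> sum_list l = e}"
  proof (rule bij_betwI')
    fix \<alpha> \<beta> :: "'n \<Rightarrow> nat"
    show "map \<alpha> xs = map \<beta> xs \<longleftrightarrow> \<alpha> = \<beta>"
      using xs by (auto simp: map_eq_conv)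
  next
    fix \<alpha> :: "'n \<Rightarrow> nat"
    assume "\<alpha> \<in> exponents e e"
    then show "map \<alpha> xs \<in> {l. length l = CARD('n) \<and> sum_list l = e}"
      using xs by (simp add: length exponents_iff sum_list_distinct_conv_sum_set)
  next
    fix l :: "nat list"
    assume l: "l \<in> {l. length l = CARD('n) \<and> sum_list l = e}"
    define \<alpha> where "\<alpha> x = (the (map_of (zip xs l) x))" for x
    have map: "map \<alpha> xs = l"
    proof (rule nth_equalityI)
      fix i assume i: "i < length (map \<alpha> xs)"
      then show "map \<alpha> xs ! i = l ! i"
        using l length xs(1) by (simp add: \<alpha>_def map_of_zip_nth)
    qed (use l length in simp)
    then have "sum \<alpha> UNIV = e"
      using xs l sum_list_distinct_conv_sum_set[OF xs(1), of \<alpha>] by simp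
    then show "\<exists>\<alpha>\<in>exponents e e. l = map \<alpha> xs"
      using map by (intro bexI[of _ \<alpha>]) (auto simp: exponents_iff)
  qed
  show ?thesis
    using bij_betw_same_card[OF bij] card_length_sum_list[of "CARD('n)" e] by simp
qed

lemma card_exponents_le: "card (exponents 0 d :: ('n::finite \<Rightarrow> nat) set) = (d + CARD('n)) choose CARD('n)"
proof -
  have "(exponents 0 d :: ('n \<Rightarrow> nat) set) = (\<Union>e\<in>{..d}. exponents e e)"
    by (auto simp: exponents_iff)
  then have "card (exponents 0 d :: ('n \<Rightarrow> nat) set) = (\<Sum>e\<le>d. card (exponents e e :: ('n \<Rightarrow> nat) set))"
    by (simp only:) (intro card_UN_disjoint; auto simp: exponents_iff)
  also have "\<dots> = (\<Sum>e\<le>d. ((CARD('n) - 1) + e) choose e)"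
    by (simp add: card_exponents_eq add.commute)
  also have "\<dots> = Suc (CARD('n) - 1 + d) choose d"
    by (rule sum_choose_lower)
  also have "Suc (CARD('n) - 1 + d) = d + CARD('n)"
    by (simp add: Suc_le_eq)
  also have "\<dots> choose d = (d + CARD('n)) choose CARD('n)"
    using binomial_symmetric[of d "d + CARD('n)"] by simp
  finally show ?thesis .
qed

text \<open>The right-hand side is (d + 1) (d + 2) ... (d + n), with every factor at least d +
  1.\<close>

lemma power_le_fact_binomial: "(d + 1) ^ n \<le> fact n * ((d + n) choose n)"
proof (induction n)
  case (Suc n)
  have "(d + 1) ^ Suc n \<le> (d + Suc n) * (fact n * ((d + n) choose n))"
    unfolding power_Suc by (intro mult_mono Suc.IH) auto
  also have "\<dots> = fact n * (Suc (d + n) * ((d + n) choose n))"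
    by (simp only: add_Suc_right mult.left_commute)
  also have "Suc (d + n) * ((d + n) choose n) = Suc n * (Suc (d + n) choose Suc n)"
    using Suc_times_binomial_eq[of "d + n" n] by (simp only: mult.commute)
  finally show ?case
    unfolding fact_Suc add_Suc_right by (simp only: mult_ac of_nat_id)
qed simp

text \<open>The subtracted \<open>fact\<close> pays for the missing constant monomial. The base d +
  1 absorbs the rounding down in the later choice of \<open>D\<close>.\<close>

lemma fact_card_exponents_ge:
  "real (d + 1) ^ CARD('n) - fact (CARD('n)) \<le>
    fact (CARD('n)) * real (card (exponents 1 d :: ('n::finite \<Rightarrow> nat) set))"
proof -
  have "exponents 0 d = insert 0 (exponents 1 d :: ('n \<Rightarrow> nat) set)" "0 \<notin> (exponents 1 d :: ('n \<Rightarrow> nat) set)"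
    by (auto simp: exponents_iff fun_eq_iff Suc_le_eq)
  then have "(d + CARD('n)) choose CARD('n) = Suc (card (exponents 1 d :: ('n \<Rightarrow> nat) set))"
    using card_exponents_le[of d, where ?'n = 'n] by simp
  then have "(d + 1) ^ CARD('n) \<le> fact (CARD('n)) * Suc (card (exponents 1 d :: ('n \<Rightarrow> nat) set))"
    using power_le_fact_binomial[of d "CARD('n)"] by simp
  then have "real ((d + 1) ^ CARD('n)) \<le> real (fact (CARD('n)) * Suc (card (exponents 1 d :: ('n \<Rightarrow> nat) set)))"
    by (simp only: of_nat_le_iff)
  then show ?thesis
    by (simp add: algebra_simps)
qed

text \<open>Generous only in terms below m^n, which disappear in the limit.\<close>

lemma fact_card_exponents_less_le:
  "fact (CARD('n)) * real (card {\<alpha>::'n::finite \<Rightarrow> nat. sum \<alpha> UNIV < m}) \<le> real (m + CARD('n)) ^ CARD('n)"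
proof -
  have "{\<alpha>::'n \<Rightarrow> nat. sum \<alpha> UNIV < m} \<subseteq> exponents 0 m"
    by (auto simp: exponents_iff)
  then have "card {\<alpha>::'n \<Rightarrow> nat. sum \<alpha> UNIV < m} \<le> (m + CARD('n)) choose CARD('n)"
    using card_mono[OF finite_exponents] card_exponents_le by metis
  then have "fact (CARD('n)) * card {\<alpha>::'n \<Rightarrow> nat. sum \<alpha> UNIV < m} \<le> ((m + CARD('n)) choose CARD('n)) * fact (CARD('n))"
    by (simp add: mult.commute)
  also have "\<dots> \<le> (m + CARD('n)) ^ CARD('n)"
    by (rule binomial_fact_pow)
  finally have "real (fact (CARD('n)) * card {\<alpha>::'n \<Rightarrow> nat. sum \<alpha> UNIV < m}) \<le> real ((m + CARD('n)) ^ CARD('n))"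
    by (simp only: of_nat_le_iff)
  then show ?thesis
    by simp
qed

lemma finite_subfield_pCons: "finite_subfield (\<lambda>c::'a::{field,finite}. [:c:])"
proof
  have "inj (\<lambda>n. monom (1 :: 'a) n)"
    by (rule injI) (metis monom_eq_iff' one_neq_zero)
  then show "infinite (UNIV :: 'a poly set)"
    using finite_subset[OF subset_UNIV, of "range (\<lambda>n. monom (1 :: 'a) n)"] finite_imageD by auto
qed (auto simp: one_pCons)

section \<open>The maximal function\<close>

lemma maximal_function_attained:
  obtains a where "maximal_function f u = (\<Sum>t\<in>UNIV. cmod (f (a + t *s u)))"
proof -
  define S where "S = range (\<lambda>a. \<Sum>t\<in>UNIV. cmod (f (a + t *s u)))"
  have "finite S" "S \<noteq> {}"
    by (auto simp: S_def)
  then have "Sup S \<in> S"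
    using Max_in cSup_eq_Max by metis
  then show ?thesis
    using that by (auto simp: maximal_function_def S_def)
qed

lemma maximal_function_nonneg: "maximal_function f u \<ge> 0"
  by (metis maximal_function_attained norm_ge_zero sum_nonneg)

lemma maximal_function_scale:
  assumes "c \<noteq> 0"
  shows "maximal_function f (c *s u) = maximal_function f u"
proof -
  have "(\<Sum>t\<in>UNIV. cmod (f (a + t *s (c *s u)))) = (\<Sum>t\<in>UNIV. cmod (f (a + t *s u)))" for a
    by (rule sum.reindex_bij_witness[of _ "\<lambda>t. t / c" "\<lambda>t. t * c"])
      (use assms in \<open>auto simp: vector_smult_assoc\<close>)
  then show ?thesis
    by (simp add: maximal_function_def)
qed

text \<open>Passage from vectors, where the counting runs, to directions: a class is the injective
  image of the q - 1 nonzero scalars under multiplication of its representative.\<close>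

lemma sum_nonzero_eq_sum_directions:
  fixes r :: "('a::{field,finite} ^ 'n::finite) set \<Rightarrow> 'a ^ 'n" and \<phi> :: "'a ^ 'n \<Rightarrow> real"
  assumes r: "representatives r" and \<phi>: "\<And>c u. c \<noteq> 0 \<Longrightarrow> \<phi> (c *s u) = \<phi> u"
  shows "(\<Sum>u\<in>- {0}. \<phi> u) = real (CARD('a) - 1) * (\<Sum>U\<in>directions. \<phi> (r U))"
proof -
  have equiv: "equiv {v :: 'a ^ 'n. v \<noteq> 0} proportional"
  proof (rule equivI)
    show "proportional \<subseteq> {v :: 'a ^ 'n. v \<noteq> 0} \<times> {v. v \<noteq> 0}"
      by (auto simp: proportional_def)
    show "refl_on {v :: 'a ^ 'n. v \<noteq> 0} proportional"
      by (auto simp: refl_on_def proportional_def intro!: exI[of _ 1])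
    show "sym (proportional :: ('a ^ 'n) rel)"
    proof (rule symI)
      fix u v :: "'a ^ 'n" assume "(u, v) \<in> proportional"
      then obtain c where "u \<noteq> 0" "v \<noteq> 0" "c \<noteq> 0" "v = c *s u"
        by (auto simp: proportional_def)
      then show "(v, u) \<in> proportional"
        by (auto simp: proportional_def vector_smult_assoc intro!: exI[of _ "inverse c"])
    qed
    show "trans (proportional :: ('a ^ 'n) rel)"
    proof (rule transI)
      fix u v w :: "'a ^ 'n" assume "(u, v) \<in> proportional" "(v, w) \<in> proportional"
      then obtain c d where "u \<noteq> 0" "w \<noteq> 0" "c \<noteq> 0" "v = c *s u" "d \<noteq> 0" "w = d *s v"
        by (auto simp: proportional_def)
      then show "(u, w) \<in> proportional"
        by (auto simp: proportional_def vector_smult_assoc intro!: exI[of _ "d * c"])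
    qed
  qed
  have U: "(\<Sum>u\<in>U. \<phi> u) = real (CARD('a) - 1) * \<phi> (r U)" if U: "U \<in> directions" for U
  proof -
    have rU: "r U \<in> U"
      using r U by (simp add: representatives_def)
    then have "r U \<noteq> 0"
      using U in_quotient_imp_subset[OF equiv] by (auto simp: directions_def)
    have "U = proportional `` {r U}"
      using quotient_eq_iff[OF equiv] rU U equiv_class_eq_iff[OF equiv] in_quotient_imp_closed[OF equiv]
      unfolding directions_def by (metis Image_singleton_iff equiv_class_eq[OF equiv] quotientE)
    also have "\<dots> = (\<lambda>c. c *s r U) ` (- {0})"
      using \<open>r U \<noteq> 0\<close> by (auto simp: proportional_def)
    finally have U_eq: "U = (\<lambda>c. c *s r U) ` (- {0})" .
    have inj: "inj_on (\<lambda>c. c *s r U) (- {0})"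
      using \<open>r U \<noteq> 0\<close> by (auto simp: inj_on_def)
    have "(\<Sum>u\<in>U. \<phi> u) = (\<Sum>c\<in>- {0}. \<phi> (c *s r U))"
      by (subst U_eq, subst sum.reindex[OF inj]) simp
    also have "\<dots> = (\<Sum>c\<in>- {0 :: 'a}. \<phi> (r U))"
      by (intro sum.cong refl \<phi>) auto
    also have "\<dots> = real (CARD('a) - 1) * \<phi> (r U)"
      by (simp add: Compl_eq_Diff_UNIV card_Diff_singleton)
    finally show ?thesis .
  qed
  have "- {0} = \<Union>(directions :: ('a ^ 'n) set set)"
    using Union_quotient[OF equiv] by (auto simp: directions_def)
  then have "(\<Sum>u\<in>- {0}. \<phi> u) = (\<Sum>U\<in>directions. \<Sum>u\<in>U. \<phi> u)"
    using sum.Union_disjoint[of directions \<phi>] quotient_disj[OF equiv] by (auto simp: directions_def)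
  then show ?thesis
    by (simp add: U sum_distrib_left)
qed

text \<open>The inequality at scale k, with the floors of k |f| as multiplicities. The subtracted q
  pays for rounding at the q points of a line, \<open>fact\<close> for the constant monomial, the
  added n for the estimate of low-degree monomials.\<close>

lemma sum_maximal_function_le_discrete:
  fixes f :: "'a::{field,finite} ^ 'n::finite \<Rightarrow> complex" and k :: nat
  defines "q \<equiv> real CARD('a)"
  shows "(\<Sum>u\<in>- {0}. (max 0 (k * maximal_function f u - q) / (2 - 1 / q)) ^ CARD('n) - fact (CARD('n))) \<le>
    card (- {0} :: ('a ^ 'n) set) * (\<Sum>x\<in>UNIV. (k * cmod (f x) + CARD('n)) ^ CARD('n))"
proof -
  interpret finite_subfield "\<lambda>c::'a. [:c:]"
    by (rule finite_subfield_pCons)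
  have q: "q \<ge> 2" "CARD('a) \<ge> 2"
    using card_field_ge_2 by (simp_all add: q_def)
  have "\<forall>u. \<exists>a. maximal_function f u = (\<Sum>t\<in>UNIV. cmod (f (a + t *s u)))"
    using maximal_function_attained by metis
  then obtain a where a: "\<And>u. maximal_function f u = (\<Sum>t\<in>UNIV. cmod (f (a u + t *s u)))"
    by metis
  define m where "m x = nat \<lfloor>k * cmod (f x)\<rfloor>" for x
  define W where "W u = (\<Sum>t\<in>UNIV. m (a u + t *s u))" for u
  \<comment> \<open>For \<open>W u > 0\<close> this is the largest d with d (2 - 1/q) < W u, cleared
    of denominators; the subtracted 1 makes the inequality strict.\<close>
  define D where "D u = (W u * CARD('a) - 1) div (2 * CARD('a) - 1)" for u
  have m: "k * cmod (f x) - 1 \<le> m x" "m x \<le> k * cmod (f x)" for x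
  proof -
    have "real (m x) = of_int \<lfloor>k * cmod (f x)\<rfloor>"
      by (simp add: m_def)
    then show "k * cmod (f x) - 1 \<le> m x" "m x \<le> k * cmod (f x)"
      by linarith+
  qed
  have W: "max 0 (k * maximal_function f u - q) \<le> W u" for u
  proof -
    have "k * maximal_function f u - q = (\<Sum>t\<in>UNIV. k * cmod (f (a u + t *s u)) - 1)"
      by (simp add: a sum_subtractf sum_distrib_left q_def)
    also have "\<dots> \<le> W u"
      unfolding W_def of_nat_sum by (intro sum_mono m)
    finally show ?thesis by simp
  qed
  have D: "W u / (2 - 1 / q) \<le> D u + 1" for u
  proof -
    have "W u * CARD('a) - 1 < (2 * CARD('a) - 1) * (D u + 1)"
      using dividend_less_times_div[of "2 * CARD('a) - 1" "W u * CARD('a) - 1"] q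
      by (simp add: D_def)
    then have "W u * CARD('a) \<le> (2 * CARD('a) - 1) * (D u + 1)"
      by linarith
    then have "real (W u * CARD('a)) \<le> real ((2 * CARD('a) - 1) * (D u + 1))"
      by (simp only: of_nat_le_iff)
    moreover have "real (2 * CARD('a) - 1) = 2 * q - 1"
      using q by (simp add: q_def of_nat_diff)
    ultimately have "W u * q \<le> (2 * q - 1) * (D u + 1)"
      by (simp only: of_nat_mult q_def)
    moreover have "2 - 1 / q = (2 * q - 1) / q"
      using q by (simp add: field_simps)
    ultimately show ?thesis
      using q by (simp add: pos_divide_le_eq mult.commute)
  qed
  have "(\<Sum>u\<in>- {0}. card (exponents 1 (D u) :: ('n \<Rightarrow> nat) set)) \<le>
    card (- {0} :: ('a ^ 'n) set) * (\<Sum>x\<in>UNIV. card {\<alpha>::'n \<Rightarrow> nat. sum \<alpha> UNIV < m x})"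
  proof (rule sum_card_exponents_le)
    fix u :: "'a ^ 'n" and d i :: nat
    assume d: "0 < d" "d \<le> D u" and i: "i \<le> d div CARD('a)"
    have "W u \<noteq> 0"
    proof
      assume "W u = 0"
      then have "D u = 0"
        by (simp add: D_def)
      then show False
        using d by simp
    qed
    have "CARD('a) * i \<le> d"
      using mult_le_mono2[OF i, of "CARD('a)"] times_div_less_eq_dividend[of "CARD('a)" d] by linarith
    have d_le: "d * (2 * CARD('a) - 1) \<le> W u * CARD('a) - 1"
      using d(2) q by (simp add: D_def less_eq_div_iff_mult_less_eq)
    \<comment> \<open>The constant enters here, as the worst case i = d/q.\<close>
    have "CARD('a) * (d + (CARD('a) - 1) * i) \<le> d * (2 * CARD('a) - 1)"
    proof -
      have "CARD('a) * (d + (CARD('a) - 1) * i) = CARD('a) * d + (CARD('a) - 1) * (CARD('a) * i)"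
        by (simp add: algebra_simps)
      also have "\<dots> \<le> CARD('a) * d + (CARD('a) - 1) * d"
        using \<open>CARD('a) * i \<le> d\<close> by simp
      also have "\<dots> = d * (2 * CARD('a) - 1)"
        using q by (simp add: diff_mult_distrib2 diff_mult_distrib mult.commute)
      finally show ?thesis .
    qed
    also note d_le
    also have "W u * CARD('a) - 1 < W u * CARD('a)"
      using \<open>W u \<noteq> 0\<close> by simp
    finally have "CARD('a) * (d + (CARD('a) - 1) * i) < CARD('a) * W u"
      by (simp only: mult.commute[of "W u"])
    then have less: "d + (CARD('a) - 1) * i < W u"
      by simp
    \<comment> \<open>Truncation can only help: the truncated differences sum to at least W u - q
      i.\<close>
    have "W u \<le> (\<Sum>c\<in>UNIV. (m (a u + c *s u) - i) + i)"
      unfolding W_def by (intro sum_mono) simp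
    also have "\<dots> = (\<Sum>c\<in>UNIV. m (a u + c *s u) - i) + CARD('a) * i"
      by (simp add: sum.distrib)
    also have "CARD('a) * i = (CARD('a) - 1) * i + i"
      using add_mult_distrib[of "CARD('a) - 1" 1 i] q by simp
    finally show "d < i + (\<Sum>c\<in>UNIV. m (a u + c *s u) - i)"
      using less by linarith
  qed
  then have count: "(\<Sum>u\<in>- {0}. real (card (exponents 1 (D u) :: ('n \<Rightarrow> nat) set))) \<le>
    card (- {0} :: ('a ^ 'n) set) * (\<Sum>x\<in>UNIV. real (card {\<alpha>::'n \<Rightarrow> nat. sum \<alpha> UNIV < m x}))"
    by (simp flip: of_nat_sum of_nat_mult)
  have "(\<Sum>u\<in>- {0}. (max 0 (k * maximal_function f u - q) / (2 - 1 / q)) ^ CARD('n) - fact (CARD('n))) \<le>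
    (\<Sum>u\<in>- {0}. fact (CARD('n)) * real (card (exponents 1 (D u) :: ('n \<Rightarrow> nat) set)))"
  proof (rule sum_mono)
    fix u :: "'a ^ 'n"
    have C: "2 - 1 / q > 0"
      using q by (simp add: field_simps)
    have "max 0 (k * maximal_function f u - q) / (2 - 1 / q) \<le> W u / (2 - 1 / q)"
      using W C by (intro divide_right_mono) auto
    also note D
    finally have "(max 0 (k * maximal_function f u - q) / (2 - 1 / q)) ^ CARD('n) \<le> real (D u + 1) ^ CARD('n)"
      using C by (intro power_mono) auto
    then show "(max 0 (k * maximal_function f u - q) / (2 - 1 / q)) ^ CARD('n) - fact (CARD('n)) \<le>
        fact (CARD('n)) * real (card (exponents 1 (D u) :: ('n \<Rightarrow> nat) set))"
      using fact_card_exponents_ge[of "D u", where ?'n = 'n] by linarith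
  qed
  also have "\<dots> \<le> fact (CARD('n)) * (card (- {0} :: ('a ^ 'n) set) * (\<Sum>x\<in>UNIV. real (card {\<alpha>::'n \<Rightarrow> nat. sum \<alpha> UNIV < m x})))"
    unfolding sum_distrib_left[symmetric] using count by (intro mult_left_mono) auto
  also have "\<dots> = card (- {0} :: ('a ^ 'n) set) * (\<Sum>x\<in>UNIV. fact (CARD('n)) * real (card {\<alpha>::'n \<Rightarrow> nat. sum \<alpha> UNIV < m x}))"
    by (simp add: sum_distrib_left mult_ac)
  also have "\<dots> \<le> card (- {0} :: ('a ^ 'n) set) * (\<Sum>x\<in>UNIV. (k * cmod (f x) + CARD('n)) ^ CARD('n))"
  proof (intro mult_left_mono sum_mono)
    fix x :: "'a ^ 'n"
    have "fact (CARD('n)) * real (card {\<alpha>::'n \<Rightarrow> nat. sum \<alpha> UNIV < m x}) \<le> real (m x + CARD('n)) ^ CARD('n)"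
      by (rule fact_card_exponents_less_le)
    also have "\<dots> \<le> (k * cmod (f x) + CARD('n)) ^ CARD('n)"
      using m(2)[of x] by (intro power_mono) auto
    finally show "fact (CARD('n)) * real (card {\<alpha>::'n \<Rightarrow> nat. sum \<alpha> UNIV < m x}) \<le> (k * cmod (f x) + CARD('n)) ^ CARD('n)" .
  qed simp
  finally show ?thesis .
qed

text \<open>The discrete inequality at scale \<open>Suc k\<close> is multiplied by
  \<open>\<epsilon> k ^ n\<close>; every error term then carries a positive power of
  \<open>\<epsilon> k\<close>.\<close>

lemma sum_maximal_function_le:
  fixes f :: "'a::{field,finite} ^ 'n::finite \<Rightarrow> complex"
  defines "q \<equiv> real CARD('a)"
  shows "(\<Sum>u\<in>- {0}. (maximal_function f u / (2 - 1 / q)) ^ CARD('n)) \<le>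
    card (- {0} :: ('a ^ 'n) set) * (\<Sum>x\<in>UNIV. cmod (f x) ^ CARD('n))"
proof -
  define X where "X = (- {0} :: ('a ^ 'n) set)"
  define n where "n = CARD('n)"
  define \<epsilon> where "\<epsilon> k = inverse (real (Suc k))" for k
  have \<epsilon>: "\<epsilon> \<longlonglongrightarrow> 0"
    unfolding \<epsilon>_def by (rule LIMSEQ_inverse_real_of_nat)
  have "n > 0"
    by (simp add: n_def)
  have "(\<lambda>k. \<Sum>u\<in>X. (max 0 (maximal_function f u - q * \<epsilon> k) / (2 - 1 / q)) ^ n - fact n * \<epsilon> k ^ n)
    \<longlonglongrightarrow> (\<Sum>u\<in>X. (max 0 (maximal_function f u - q * 0) / (2 - 1 / q)) ^ n - fact n * 0 ^ n)"
    unfolding divide_inverse by (intro tendsto_intros tendsto_max \<epsilon>)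
  moreover have "(\<lambda>k. card X * (\<Sum>x\<in>UNIV. (cmod (f x) + n * \<epsilon> k) ^ n))
    \<longlonglongrightarrow> card X * (\<Sum>x\<in>UNIV. (cmod (f x) + real n * 0) ^ n)"
    by (intro tendsto_intros \<epsilon>)
  moreover have "(\<Sum>u\<in>X. (max 0 (maximal_function f u - q * \<epsilon> k) / (2 - 1 / q)) ^ n - fact n * \<epsilon> k ^ n) \<le>
    card X * (\<Sum>x\<in>UNIV. (cmod (f x) + n * \<epsilon> k) ^ n)" for k
  proof -
    have \<epsilon>k: "\<epsilon> k > 0" "real (Suc k) * \<epsilon> k = 1"
      by (simp_all add: \<epsilon>_def)
    have "max 0 (maximal_function f u - q * \<epsilon> k) = \<epsilon> k * max 0 (Suc k * maximal_function f u - q)" for u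
    proof -
      have "\<epsilon> k * (Suc k * maximal_function f u - q) = (Suc k * \<epsilon> k) * maximal_function f u - q * \<epsilon> k"
        by (simp only: right_diff_distrib mult_ac)
      then have "maximal_function f u - q * \<epsilon> k = \<epsilon> k * (Suc k * maximal_function f u - q)"
        by (simp only: \<epsilon>k(2) mult_1)
      then show ?thesis
        using \<epsilon>k(1) by (simp add: max_def zero_le_mult_iff not_le)
    qed
    then have "(\<Sum>u\<in>X. (max 0 (maximal_function f u - q * \<epsilon> k) / (2 - 1 / q)) ^ n - fact n * \<epsilon> k ^ n) =
      \<epsilon> k ^ n * (\<Sum>u\<in>X. (max 0 (Suc k * maximal_function f u - q) / (2 - 1 / q)) ^ n - fact n)"
      unfolding sum_distrib_left
      by (intro sum.cong refl) (simp add: power_mult_distrib power_divide right_diff_distrib)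
    also have "\<dots> \<le> \<epsilon> k ^ n * (card X * (\<Sum>x\<in>UNIV. (Suc k * cmod (f x) + n) ^ n))"
      using sum_maximal_function_le_discrete[of "Suc k" f] \<epsilon>k(1) unfolding X_def n_def q_def
      by (intro mult_left_mono) auto
    also have "\<dots> = card X * (\<Sum>x\<in>UNIV. (\<epsilon> k * (Suc k * cmod (f x) + n)) ^ n)"
      by (simp only: sum_distrib_left power_mult_distrib mult.left_commute)
    also have "(\<lambda>x. \<epsilon> k * (Suc k * cmod (f x) + n)) = (\<lambda>x. cmod (f x) + n * \<epsilon> k)"
    proof
      fix x
      have "\<epsilon> k * (Suc k * cmod (f x) + n) = (Suc k * \<epsilon> k) * cmod (f x) + n * \<epsilon> k"
        by (simp only: distrib_left mult_ac)
      then show "\<epsilon> k * (Suc k * cmod (f x) + n) = cmod (f x) + n * \<epsilon> k"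
        by (simp only: \<epsilon>k(2) mult_1)
    qed
    finally show ?thesis .
  qed
  ultimately have "(\<Sum>u\<in>X. (max 0 (maximal_function f u - q * 0) / (2 - 1 / q)) ^ n - fact n * 0 ^ n) \<le>
      card X * (\<Sum>x\<in>UNIV. (cmod (f x) + real n * 0) ^ n)"
    by (intro LIMSEQ_le) auto
  \<comment> \<open>Positivity of n makes the limit term \<open>fact n * 0 ^ n\<close>
    vanish.\<close>
  then show ?thesis
    using \<open>n > 0\<close> by (simp add: max_absorb2 maximal_function_nonneg zero_power X_def n_def)
qed

theorem theorem1p10:
  fixes f :: "'a::{field,finite} ^ 'n::finite \<Rightarrow> complex"
    and r :: "('a ^ 'n) set \<Rightarrow> 'a ^ 'n"
    and n q :: nat
  assumes "n = CARD('n)"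
    and "q = CARD('a)"
    and "representatives r"
  shows "(\<Sum>x\<in>UNIV. cmod (f x) ^ n) \<ge>
    1 / (2 - 1 / real q) ^ n
      * (1 / real (card (directions :: ('a ^ 'n) set set)))
      * (\<Sum>U\<in>directions. \<bar>maximal_function f (r U)\<bar> ^ n)"
proof -
  define p where "p = real (CARD('a) - 1)"
  define N where "N = real (card (directions :: ('a ^ 'n) set set))"
  define C where "C = 2 - 1 / real q"
  \<comment> \<open>The constant function 1 counts q - 1 nonzero vectors per direction; the factor
    \<open>p\<close> cancels below.\<close>
  have X: "real (card (- {0} :: ('a ^ 'n) set)) = p * N"
    using sum_nonzero_eq_sum_directions[OF assms(3), of "\<lambda>_. 1"] by (simp add: p_def N_def)
  have "(1 :: 'a ^ 'n) \<in> - {0}"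
    by (simp add: vec_eq_iff)
  then have "real (card (- {0} :: ('a ^ 'n) set)) > 0"
    by (metis card_gt_0_iff empty_iff finite of_nat_0_less_iff)
  then have pos: "p > 0" "N > 0"
    unfolding X by (auto simp: p_def N_def zero_less_mult_iff)
  have "(\<Sum>u\<in>- {0}. (maximal_function f u / C) ^ n) = p * (\<Sum>U\<in>directions. (maximal_function f (r U) / C) ^ n)"
    unfolding p_def by (rule sum_nonzero_eq_sum_directions[OF assms(3)]) (simp add: maximal_function_scale)
  then have "p * (\<Sum>U\<in>directions. (maximal_function f (r U) / C) ^ n) \<le> p * (N * (\<Sum>x\<in>UNIV. cmod (f x) ^ n))"
    using sum_maximal_function_le[of f] X by (simp add: assms(1,2) C_def mult.assoc)
  then have "(\<Sum>U\<in>directions. (maximal_function f (r U) / C) ^ n) \<le> N * (\<Sum>x\<in>UNIV. cmod (f x) ^ n)"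
    using pos by simp
  moreover have "(\<Sum>U\<in>directions. (maximal_function f (r U) / C) ^ n) =
      (\<Sum>U\<in>directions. \<bar>maximal_function f (r U)\<bar> ^ n) / C ^ n"
    by (simp add: power_divide sum_divide_distrib maximal_function_nonneg)
  ultimately have "(\<Sum>U\<in>directions. \<bar>maximal_function f (r U)\<bar> ^ n) / C ^ n / N \<le> (\<Sum>x\<in>UNIV. cmod (f x) ^ n)"
    using pos by (simp only: pos_divide_le_eq mult.commute)
  then show ?thesis
    unfolding C_def[symmetric] N_def[symmetric] by (simp add: mult.commute)
qed

end
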